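(* The canonical inclusion of frames into arrow algebras determines a $2$-fully faithful $2$-functor $\mathsf{Frm}\hookrightarrow\mathsf{ArrAlg}_{\mathsf{cd}}$. Explicitly, for all frames $\mathcal O(Y)$ and $\mathcal O(X)$ there is an equivalence of preorder categories $$\mathsf{Frm}(\mathcal O(Y),\mathcal O(X))\simeq\mathsf{ArrAlg}_{\mathsf{cd}}(\mathcal O(Y),\mathcal O(X)).$$
   Context: An arrow algebra $\mathcal A=(A,\preccurlyeq,\to,S)$ consists of a poset $(A,\preccurlyeq)$ with all meets $\bigwedge$; a binary operation $\to$ on $A$ (bracketed to the right), antitone in the first and monotone in the second argument; and a subset $S\subseteq A$ (the separator) which is upward closed, closed under modus ponens ($a\to b\in S$ and $a\in S$ imply $b\in S$), and contains the combinators $\mathbf k=\bigwedge_{a,b}a\to b\to a$, $\mathbf s=\bigwedge_{a,b,c}(a\to b\to c)\to(a\to b)\to a\to c$, and $\mathbf a=\bigwedge_{a,(b_i)_{i\in I},(c_i)_{i\in I}}\big(\bigwedge_{i\in I}a\to b_i\to c_i\big)\to a\to\bigwedge_{i\in I}(b_i\to c_i)$. An implicative morphism $f:\mathcal A\to\mathcal B$ is a function $f:A\to B$ such that: (i) $f(a)\in S_B$ for every $a\in S_A$; (ii) there is $r\in S_B$ with $r\preccurlyeq f(a\to a')\to f(a)\to f(a')$ for all $a,a'\in A$; (iii) for every $X\subseteq A\times A$, if $\bigwedge_{(a,a')\in X}a\to a'\in S_A$ then $\bigwedge_{(a,a')\in X}f(a)\to f(a')\in S_B$. Write $f\vdash f'$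 if $\bigwedge_{a\in A}f(a)\to f'(a)\in S_B$. An implicative morphism $f:\mathcal A\to\mathcal B$ is computationally dense if there is an implicative morphism $h:\mathcal B\to\mathcal A$ with $fh\vdash\mathrm{id}_B$ and $\mathrm{id}_A\vdash hf$. $\mathsf{ArrAlg}_{\mathsf{cd}}$ is the preorder-enriched category of arrow algebras and computationally dense implicative morphisms. A frame is seen as an arrow algebra canonically with its order, its Heyting implication, and separator $\{\top\}$. $\mathsf{Frm}$ is the category of frames and frame homomorphisms (maps preserving finite meets and arbitrary joins), preorder-enriched by the pointwise order. The inclusion sends a frame to its canonical arrow algebra and a frame homomorphism to itself. A $2$-functor is $2$-fully faithful if it induces equivalences of preorders on hom-preorders. *)

theory Defs
  imports "HOL-Algebra.Complete_Lattice" "HOL-Library.FuncSet"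
begin

section \<open>Preorder-enriched categories and 2-functors\<close>

text \<open>A 2-cell is an inequality in a hom-preorder. Hom-sets of distinct pairs of objects may
  overlap, so composition and the action of a functor on morphisms take the objects as arguments.\<close>

record ('o, 'm) precat =
  Obj :: "'o set"
  Hom :: "'o \<Rightarrow> 'o \<Rightarrow> 'm set"
  Hle :: "'o \<Rightarrow> 'o \<Rightarrow> 'm \<Rightarrow> 'm \<Rightarrow> bool"
  Idn :: "'o \<Rightarrow> 'm"
  Cmp :: "'o \<Rightarrow> 'o \<Rightarrow> 'o \<Rightarrow> 'm \<Rightarrow> 'm \<Rightarrow> 'm"  \<comment> \<open>\<open>Cmp C X Y Z g f\<close> is \<open>g\<close> after \<open>f\<close>\<close>

locale preorder_enriched_category =
  fixes C :: "('o, 'm) precat"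
  assumes Idn_in_Hom: "X \<in> Obj C \<Longrightarrow> Idn C X \<in> Hom C X X"
    and Cmp_in_Hom: "\<lbrakk>X \<in> Obj C; Y \<in> Obj C; Z \<in> Obj C; f \<in> Hom C X Y; g \<in> Hom C Y Z\<rbrakk>
      \<Longrightarrow> Cmp C X Y Z g f \<in> Hom C X Z"
    and Idn_left: "\<lbrakk>X \<in> Obj C; Y \<in> Obj C; f \<in> Hom C X Y\<rbrakk> \<Longrightarrow> Cmp C X Y Y (Idn C Y) f = f"
    and Idn_right: "\<lbrakk>X \<in> Obj C; Y \<in> Obj C; f \<in> Hom C X Y\<rbrakk> \<Longrightarrow> Cmp C X X Y f (Idn C X) = f"
    and Cmp_assoc: "\<lbrakk>W \<in> Obj C; X \<in> Obj C; Y \<in> Obj C; Z \<in> Obj C;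
        f \<in> Hom C W X; g \<in> Hom C X Y; h \<in> Hom C Y Z\<rbrakk>
      \<Longrightarrow> Cmp C W Y Z h (Cmp C W X Y g f) = Cmp C W X Z (Cmp C X Y Z h g) f"
    and Hle_refl: "\<lbrakk>X \<in> Obj C; Y \<in> Obj C; f \<in> Hom C X Y\<rbrakk> \<Longrightarrow> Hle C X Y f f"
    and Hle_trans: "\<lbrakk>X \<in> Obj C; Y \<in> Obj C; f \<in> Hom C X Y; g \<in> Hom C X Y; h \<in> Hom C X Y;
        Hle C X Y f g; Hle C X Y g h\<rbrakk> \<Longrightarrow> Hle C X Y f h"
    and Cmp_mono: "\<lbrakk>X \<in> Obj C; Y \<in> Obj C; Z \<in> Obj C; f \<in> Hom C X Y; f' \<in> Hom C X Y;
        g \<in> Hom C Y Z; g' \<in> Hom C Y Z; Hle C X Y f f'; Hle C Y Z g g'\<rbrakk>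
      \<Longrightarrow> Hle C X Z (Cmp C X Y Z g f) (Cmp C X Y Z g' f')"

locale two_functor =
  C: preorder_enriched_category C + D: preorder_enriched_category D
  for C :: "('o, 'm) precat" and D :: "('p, 'n) precat"
    and F0 :: "'o \<Rightarrow> 'p" and F1 :: "'o \<Rightarrow> 'o \<Rightarrow> 'm \<Rightarrow> 'n" +
  assumes F0_Obj: "X \<in> Obj C \<Longrightarrow> F0 X \<in> Obj D"
    and F1_Hom: "\<lbrakk>X \<in> Obj C; Y \<in> Obj C; f \<in> Hom C X Y\<rbrakk> \<Longrightarrow> F1 X Y f \<in> Hom D (F0 X) (F0 Y)"
    and F1_mono: "\<lbrakk>X \<in> Obj C; Y \<in> Obj C; f \<in> Hom C X Y; g \<in> Hom C X Y; Hle C X Y f g\<rbrakk>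
      \<Longrightarrow> Hle D (F0 X) (F0 Y) (F1 X Y f) (F1 X Y g)"
    and F1_Idn: "X \<in> Obj C \<Longrightarrow> F1 X X (Idn C X) = Idn D (F0 X)"
    and F1_Cmp: "\<lbrakk>X \<in> Obj C; Y \<in> Obj C; Z \<in> Obj C; f \<in> Hom C X Y; g \<in> Hom C Y Z\<rbrakk>
      \<Longrightarrow> F1 X Z (Cmp C X Y Z g f) = Cmp D (F0 X) (F0 Y) (F0 Z) (F1 Y Z g) (F1 X Y f)"

definition preorder_on_set :: "'a set \<Rightarrow> ('a \<Rightarrow> 'a \<Rightarrow> bool) \<Rightarrow> bool" where
  "preorder_on_set P leP \<longleftrightarrow>
     (\<forall>x\<in>P. leP x x) \<and> (\<forall>x\<in>P. \<forall>y\<in>P. \<forall>z\<in>P. leP x y \<longrightarrow> leP y z \<longrightarrow> leP x z)"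

definition monotone_map ::
  "'a set \<Rightarrow> ('a \<Rightarrow> 'a \<Rightarrow> bool) \<Rightarrow> 'b set \<Rightarrow> ('b \<Rightarrow> 'b \<Rightarrow> bool) \<Rightarrow> ('a \<Rightarrow> 'b) \<Rightarrow> bool" where
  "monotone_map P leP Q leQ f \<longleftrightarrow> f \<in> P \<rightarrow> Q \<and> (\<forall>x\<in>P. \<forall>y\<in>P. leP x y \<longrightarrow> leQ (f x) (f y))"

text \<open>Equivalence of preorders, viewed as categories: a functor with a quasi-inverse. Isomorphism of
  two elements means inequality in both directions.\<close>

definition preorder_equivalence ::
  "'a set \<Rightarrow> ('a \<Rightarrow> 'a \<Rightarrow> bool) \<Rightarrow> 'b set \<Rightarrow> ('b \<Rightarrow> 'b \<Rightarrow> bool) \<Rightarrow> ('a \<Rightarrow> 'b) \<Rightarrow> bool" where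
  "preorder_equivalence P leP Q leQ f \<longleftrightarrow>
     preorder_on_set P leP \<and> preorder_on_set Q leQ \<and> monotone_map P leP Q leQ f \<and>
     (\<exists>g. monotone_map Q leQ P leP g \<and>
        (\<forall>x\<in>P. leP x (g (f x)) \<and> leP (g (f x)) x) \<and>
        (\<forall>y\<in>Q. leQ y (f (g y)) \<and> leQ (f (g y)) y))"

locale two_fully_faithful_two_functor = two_functor +
  assumes hom_equivalence: "\<lbrakk>X \<in> Obj C; Y \<in> Obj C\<rbrakk>
    \<Longrightarrow> preorder_equivalence (Hom C X Y) (Hle C X Y)
          (Hom D (F0 X) (F0 Y)) (Hle D (F0 X) (F0 Y)) (F1 X Y)"


section \<open>Arrow algebras\<close>

record 'a arrow_structure = "'a gorder" +
  arr :: "'a \<Rightarrow> 'a \<Rightarrow> 'a" (infixr \<open>\<leadsto>\<index>\<close> 60)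
  separator :: "'a set"

definition comb_k :: "('a, 'z) arrow_structure_scheme \<Rightarrow> 'a" where
  "comb_k A = \<Sqinter>\<^bsub>A\<^esub> {a \<leadsto>\<^bsub>A\<^esub> b \<leadsto>\<^bsub>A\<^esub> a | a b. a \<in> carrier A \<and> b \<in> carrier A}"

definition comb_s :: "('a, 'z) arrow_structure_scheme \<Rightarrow> 'a" where
  "comb_s A = \<Sqinter>\<^bsub>A\<^esub> {(a \<leadsto>\<^bsub>A\<^esub> b \<leadsto>\<^bsub>A\<^esub> c) \<leadsto>\<^bsub>A\<^esub> (a \<leadsto>\<^bsub>A\<^esub> b) \<leadsto>\<^bsub>A\<^esub> a \<leadsto>\<^bsub>A\<^esub> c | a b c.
     a \<in> carrier A \<and> b \<in> carrier A \<and> c \<in> carrier A}"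

text \<open>The families \<open>(b\<^sub>i, c\<^sub>i)\<close> over arbitrary index sets enter the third combinator only through
  the set \<open>X\<close> of their values, which is an arbitrary subset of \<open>carrier A \<times> carrier A\<close>;
  cf. \<open>comb_a_le_family\<close> below.\<close>

definition comb_a :: "('a, 'z) arrow_structure_scheme \<Rightarrow> 'a" where
  "comb_a A = \<Sqinter>\<^bsub>A\<^esub> {(\<Sqinter>\<^bsub>A\<^esub> {a \<leadsto>\<^bsub>A\<^esub> b \<leadsto>\<^bsub>A\<^esub> c | b c. (b, c) \<in> X}) \<leadsto>\<^bsub>A\<^esub> a \<leadsto>\<^bsub>A\<^esub>
       (\<Sqinter>\<^bsub>A\<^esub> {b \<leadsto>\<^bsub>A\<^esub> c | b c. (b, c) \<in> X}) | a X.
     a \<in> carrier A \<and> X \<subseteq> carrier A \<times> carrier A}"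

locale arrow_algebra = partial_order A for A :: "('a, 'z) arrow_structure_scheme" (structure) +
  assumes meets_exist: "X \<subseteq> carrier A \<Longrightarrow> \<exists>i. greatest A i (Lower A X)"
    and arr_closed: "\<lbrakk>a \<in> carrier A; b \<in> carrier A\<rbrakk> \<Longrightarrow> a \<leadsto> b \<in> carrier A"
    and arr_mono: "\<lbrakk>a \<in> carrier A; a' \<in> carrier A; b \<in> carrier A; b' \<in> carrier A;
        a' \<sqsubseteq> a; b \<sqsubseteq> b'\<rbrakk> \<Longrightarrow> a \<leadsto> b \<sqsubseteq> a' \<leadsto> b'"
    and separator_subset: "separator A \<subseteq> carrier A"
    and separator_upward: "\<lbrakk>a \<in> separator A; b \<in> carrier A; a \<sqsubseteq> b\<rbrakk> \<Longrightarrow> b \<in> separator A"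
    and separator_mp: "\<lbrakk>a \<in> carrier A; b \<in> carrier A; a \<leadsto> b \<in> separator A; a \<in> separator A\<rbrakk>
      \<Longrightarrow> b \<in> separator A"
    and comb_k_in: "comb_k A \<in> separator A"
    and comb_s_in: "comb_s A \<in> separator A"
    and comb_a_in: "comb_a A \<in> separator A"

sublocale arrow_algebra \<subseteq> complete_lattice A
proof (rule complete_lattice_criterion1)
  show "\<exists>g. greatest A g (carrier A)"
    using meets_exist[of "{}"] by simp
qed (rule meets_exist)

lemma (in arrow_algebra) comb_a_le_family:
  assumes a: "a \<in> carrier A"
    and b: "b \<in> I \<rightarrow> carrier A" and c: "c \<in> I \<rightarrow> carrier A"
  shows "comb_a A \<sqsubseteq>
    (\<Sqinter> {a \<leadsto> b i \<leadsto> c i | i. i \<in> I}) \<leadsto> a \<leadsto> (\<Sqinter> {b i \<leadsto> c i | i. i \<in> I})"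
proof -
  let ?X = "(\<lambda>i. (b i, c i)) ` I"
  have X: "?X \<subseteq> carrier A \<times> carrier A"
    using b c by auto
  have eq1: "{a \<leadsto> b i \<leadsto> c i | i. i \<in> I} = {a \<leadsto> b \<leadsto> c | b c. (b, c) \<in> ?X}"
    by auto
  have eq2: "{b i \<leadsto> c i | i. i \<in> I} = {b \<leadsto> c | b c. (b, c) \<in> ?X}"
    by auto
  show ?thesis
    unfolding comb_a_def
  proof (rule inf_lower)
    show "(\<Sqinter> {a \<leadsto> b i \<leadsto> c i | i. i \<in> I}) \<leadsto> a \<leadsto> (\<Sqinter> {b i \<leadsto> c i | i. i \<in> I})
      \<in> {(\<Sqinter> {a \<leadsto> b \<leadsto> c | b c. (b, c) \<in> X}) \<leadsto> a \<leadsto> (\<Sqinter> {b \<leadsto> c | b c. (b, c) \<in> X}) | a X.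
          a \<in> carrier A \<and> X \<subseteq> carrier A \<times> carrier A}"
      unfolding eq1 eq2 using a X by blast
    show "{(\<Sqinter> {a \<leadsto> b \<leadsto> c | b c. (b, c) \<in> X}) \<leadsto> a \<leadsto> (\<Sqinter> {b \<leadsto> c | b c. (b, c) \<in> X}) | a X.
          a \<in> carrier A \<and> X \<subseteq> carrier A \<times> carrier A} \<subseteq> carrier A"
      by (auto intro!: arr_closed inf_closed)
  qed
qed

text \<open>Morphisms are extensional functions on carriers, so that equality of morphisms is equality of
  functions between the carriers.\<close>

definition implicative_morphism ::
  "('a, 'y) arrow_structure_scheme \<Rightarrow> ('b, 'z) arrow_structure_scheme \<Rightarrow> ('a \<Rightarrow> 'b) \<Rightarrow> bool" where
  "implicative_morphism A B f \<longleftrightarrow>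
     f \<in> carrier A \<rightarrow>\<^sub>E carrier B \<and>
     (\<forall>a\<in>separator A. f a \<in> separator B) \<and>
     (\<exists>r\<in>separator B. \<forall>a\<in>carrier A. \<forall>a'\<in>carrier A.
        r \<sqsubseteq>\<^bsub>B\<^esub> f (a \<leadsto>\<^bsub>A\<^esub> a') \<leadsto>\<^bsub>B\<^esub> f a \<leadsto>\<^bsub>B\<^esub> f a') \<and>
     (\<forall>X \<subseteq> carrier A \<times> carrier A.
        \<Sqinter>\<^bsub>A\<^esub> {a \<leadsto>\<^bsub>A\<^esub> a' | a a'. (a, a') \<in> X} \<in> separator A \<longrightarrow>
        \<Sqinter>\<^bsub>B\<^esub> {f a \<leadsto>\<^bsub>B\<^esub> f a' | a a'. (a, a') \<in> X} \<in> separator B)"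

definition entails ::
  "('a, 'y) arrow_structure_scheme \<Rightarrow> ('b, 'z) arrow_structure_scheme
    \<Rightarrow> ('a \<Rightarrow> 'b) \<Rightarrow> ('a \<Rightarrow> 'b) \<Rightarrow> bool" where
  "entails A B f f' \<longleftrightarrow> \<Sqinter>\<^bsub>B\<^esub> {f a \<leadsto>\<^bsub>B\<^esub> f' a | a. a \<in> carrier A} \<in> separator B"

definition computationally_dense ::
  "('a, 'y) arrow_structure_scheme \<Rightarrow> ('b, 'z) arrow_structure_scheme \<Rightarrow> ('a \<Rightarrow> 'b) \<Rightarrow> bool" where
  "computationally_dense A B f \<longleftrightarrow>
     (\<exists>h. implicative_morphism B A h \<and>
        entails B B (compose (carrier B) f h) (\<lambda>x\<in>carrier B. x) \<and>
        entails A A (\<lambda>x\<in>carrier A. x) (compose (carrier A) h f))"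

definition cd_morphisms ::
  "('a, 'y) arrow_structure_scheme \<Rightarrow> ('b, 'z) arrow_structure_scheme \<Rightarrow> ('a \<Rightarrow> 'b) set" where
  "cd_morphisms A B = {f. implicative_morphism A B f \<and> computationally_dense A B f}"

text \<open>The type \<open>'u\<close> serves as the universe: the objects are all arrow algebras whose carrier is a
  set of elements of \<open>'u\<close>.\<close>

definition ArrAlg_cd :: "('u arrow_structure, 'u \<Rightarrow> 'u) precat" where
  "ArrAlg_cd = \<lparr>
     Obj = {A. arrow_algebra A},
     Hom = cd_morphisms,
     Hle = entails,
     Idn = (\<lambda>A. \<lambda>x\<in>carrier A. x),
     Cmp = (\<lambda>A B C g f. compose (carrier A) g f) \<rparr>"


section \<open>Frames\<close>

locale frame = complete_lattice L for L (structure) +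
  assumes meet_sup_distrib: "\<lbrakk>x \<in> carrier L; Y \<subseteq> carrier L\<rbrakk>
    \<Longrightarrow> x \<sqinter> (\<Squnion> Y) = \<Squnion> {x \<sqinter> y | y. y \<in> Y}"

definition frame_homs ::
  "('a, 'y) gorder_scheme \<Rightarrow> ('b, 'z) gorder_scheme \<Rightarrow> ('a \<Rightarrow> 'b) set" where
  "frame_homs L M = {f \<in> carrier L \<rightarrow>\<^sub>E carrier M.
     (\<forall>X \<subseteq> carrier L. finite X \<longrightarrow> f (\<Sqinter>\<^bsub>L\<^esub> X) = \<Sqinter>\<^bsub>M\<^esub> (f ` X)) \<and>
     (\<forall>X \<subseteq> carrier L. f (\<Squnion>\<^bsub>L\<^esub> X) = \<Squnion>\<^bsub>M\<^esub> (f ` X))}"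

definition pointwise_le ::
  "('a, 'y) gorder_scheme \<Rightarrow> ('b, 'z) gorder_scheme \<Rightarrow> ('a \<Rightarrow> 'b) \<Rightarrow> ('a \<Rightarrow> 'b) \<Rightarrow> bool" where
  "pointwise_le L M f g \<longleftrightarrow> (\<forall>x\<in>carrier L. f x \<sqsubseteq>\<^bsub>M\<^esub> g x)"

definition Frm :: "('u gorder, 'u \<Rightarrow> 'u) precat" where
  "Frm = \<lparr>
     Obj = {L. frame L},
     Hom = frame_homs,
     Hle = pointwise_le,
     Idn = (\<lambda>L. \<lambda>x\<in>carrier L. x),
     Cmp = (\<lambda>L M N g f. compose (carrier L) g f) \<rparr>"

definition heyting_imp :: "('a, 'z) gorder_scheme \<Rightarrow> 'a \<Rightarrow> 'a \<Rightarrow> 'a" where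
  "heyting_imp L a b = \<Squnion>\<^bsub>L\<^esub> {x \<in> carrier L. x \<sqinter>\<^bsub>L\<^esub> a \<sqsubseteq>\<^bsub>L\<^esub> b}"

lemma (in frame) heyting_imp_adjoint:
  assumes a: "a \<in> carrier L" and b: "b \<in> carrier L" and x: "x \<in> carrier L"
  shows "x \<sqsubseteq> heyting_imp L a b \<longleftrightarrow> x \<sqinter> a \<sqsubseteq> b"
proof
  let ?Y = "{x \<in> carrier L. x \<sqinter> a \<sqsubseteq> b}"
  let ?h = "heyting_imp L a b"
  have Y: "?Y \<subseteq> carrier L" by auto
  have h: "?h \<in> carrier L" unfolding heyting_imp_def by (rule sup_closed[OF Y])
  show "x \<sqsubseteq> ?h" if "x \<sqinter> a \<sqsubseteq> b"
    unfolding heyting_imp_def using that x by (intro sup_upper) auto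
  have comm: "y \<sqinter> a = a \<sqinter> y" for y
    unfolding meet_def by (simp add: insert_commute)
  have "?h \<sqinter> a = \<Squnion> {a \<sqinter> y | y. y \<in> ?Y}"
    unfolding comm[of ?h] unfolding heyting_imp_def by (rule meet_sup_distrib[OF a Y])
  also have "\<dots> \<sqsubseteq> b"
    by (rule sup_least) (use a b in \<open>auto simp: comm[symmetric]\<close>)
  finally have hb: "?h \<sqinter> a \<sqsubseteq> b" .
  show "x \<sqinter> a \<sqsubseteq> b" if "x \<sqsubseteq> ?h"
  proof -
    have "x \<sqinter> a \<sqsubseteq> ?h \<sqinter> a"
      using that x a h by (intro meet_le) (auto intro: le_trans[OF meet_left] meet_right)
    then show ?thesis
      using hb x a b h by (meson le_trans meet_closed)
  qed
qed

definition frame_arrow_algebra :: "'a gorder \<Rightarrow> 'a arrow_structure" where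
  "frame_arrow_algebra L = gorder.extend L \<lparr> arr = heyting_imp L, separator = {\<top>\<^bsub>L\<^esub>} \<rparr>"

lemma frame_arrow_algebra_simps [simp]:
  "carrier (frame_arrow_algebra L) = carrier L"
  "(.=\<^bsub>frame_arrow_algebra L\<^esub>) = (.=\<^bsub>L\<^esub>)"
  "(\<sqsubseteq>\<^bsub>frame_arrow_algebra L\<^esub>) = (\<sqsubseteq>\<^bsub>L\<^esub>)"
  "arr (frame_arrow_algebra L) = heyting_imp L"
  "separator (frame_arrow_algebra L) = {\<top>\<^bsub>L\<^esub>}"
  by (simp_all add: frame_arrow_algebra_def gorder.defs arrow_structure.defs)

end

theory Submission
  imports Defs
begin

text \<open>On objects and on morphisms the inclusion is injective, and so the claim is that frames form a
  full sub-2-category of arrow algebras: the computationally dense implicative morphisms between two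
  frames are exactly the frame homomorphisms, and \<^const>\<open>entails\<close> between them is the pointwise order.

  The reason is that the separator of a frame is \<open>{\<top>}\<close>, so a meet of implications lies in it if and
  only if every one of the implications is an inequality. Under this translation an implicative
  morphism is a monotone map \<open>f\<close> with \<open>f \<top> = \<top>\<close> and \<open>f (a \<rightarrow> b) \<le> f a \<rightarrow> f b\<close>, and these are the maps
  that preserve finite meets (\<open>implicative_morphism_frame_iff\<close>). A witness \<open>h\<close> of computational density
  is then a finite-meet-preserving map with \<open>f h \<le> id\<close> and \<open>id \<le> h f\<close>, that is, a right adjoint of \<open>f\<close>
  (\<open>computationally_dense_frame_iff\<close>). By the adjoint functor theorem for posets such an \<open>h\<close> exists if
  and only if \<open>f\<close> preserves joins; it preserves meets automatically, being a right adjoint. This gives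
  \<open>cd_morphisms_frame\<close>.

  Arrow algebras themselves must also be shown to form a preorder-enriched category. This rests on
  reasoning in combinatory logic uniformly in a family of elements: identity and composition of
  implications are derived from \<open>k\<close> and \<open>s\<close>, and the combinator \<open>a\<close> makes modus ponens available for
  families. Everything that concerns frames alone, including that they form a preorder-enriched
  category, is then inherited along the full inclusion
  (\<open>two_fully_faithful_full_subcategory\<close>).\<close>

section \<open>Uniformly realized families in an arrow algebra\<close>

text \<open>Entailment and the last condition on implicative morphisms say that a meet lies in the separator. As separators are
  upward closed, this amounts to a common lower bound in the separator
  (\<open>realized_iff_Inf_in_separator\<close>). The indexed form replaces set comprehensions by families, which can be
  reindexed and combined index by index.\<close>

definition realized ::
  "('a, 'z) arrow_structure_scheme \<Rightarrow> 'i set \<Rightarrow> ('i \<Rightarrow> 'a) \<Rightarrow> bool" where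
  "realized A I u \<longleftrightarrow> (\<exists>r\<in>separator A. \<forall>i\<in>I. r \<sqsubseteq>\<^bsub>A\<^esub> u i)"

lemma realized_reindex: "realized A I u \<Longrightarrow> g \<in> J \<rightarrow> I \<Longrightarrow> realized A J (\<lambda>j. u (g j))"
  unfolding realized_def by blast

lemma realized_cong: "(\<And>i. i \<in> I \<Longrightarrow> u i = v i) \<Longrightarrow> realized A I u \<longleftrightarrow> realized A I v"
  unfolding realized_def by simp

context arrow_algebra
begin

lemma realized_iff_Inf_in_separator:
  assumes u: "u \<in> I \<rightarrow> carrier A" and T: "T = u ` I"
  shows "\<Sqinter> T \<in> separator A \<longleftrightarrow> realized A I u"
proof
  have carr: "T \<subseteq> carrier A"
    using u T by auto
  show "realized A I u" if "\<Sqinter> T \<in> separator A"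
    unfolding realized_def using that inf_lower[OF carr] by (intro bexI[of _ "\<Sqinter> T"]) (auto simp: T)
  show "\<Sqinter> T \<in> separator A" if "realized A I u"
  proof -
    from that obtain r where r: "r \<in> separator A" "\<And>i. i \<in> I \<Longrightarrow> r \<sqsubseteq> u i"
      unfolding realized_def by blast
    then have "r \<in> carrier A"
      using separator_subset by blast
    then have "r \<sqsubseteq> \<Sqinter> T"
      using r(2) by (intro inf_greatest[OF carr]) (auto simp: T)
    then show ?thesis
      by (rule separator_upward[OF r(1) inf_closed[OF carr]])
  qed
qed

text \<open>Modus ponens for families. Let \<open>s\<close> bound all \<open>a i\<close> from below. Replacing each \<open>a i\<close> by \<open>s\<close> makes the
  antecedent independent of \<open>i\<close>, and then the combinator \<open>a\<close> moves the meet inside it. The consequents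
  have to be implications, because that combinator distributes only over meets of implications.\<close>

lemma realized_mp:
  assumes a: "a \<in> I \<rightarrow> carrier A" and b: "b \<in> I \<rightarrow> carrier A" and c: "c \<in> I \<rightarrow> carrier A"
    and abc: "realized A I (\<lambda>i. a i \<leadsto> b i \<leadsto> c i)" and ra: "realized A I a"
  shows "realized A I (\<lambda>i. b i \<leadsto> c i)"
proof -
  let ?P = "{b i \<leadsto> c i | i. i \<in> I}"
  obtain s where s: "s \<in> separator A" "\<And>i. i \<in> I \<Longrightarrow> s \<sqsubseteq> a i"
    using ra unfolding realized_def by blast
  obtain r where r: "r \<in> separator A" "\<And>i. i \<in> I \<Longrightarrow> r \<sqsubseteq> a i \<leadsto> b i \<leadsto> c i"
    using abc unfolding realized_def by blast
  let ?Q = "{s \<leadsto> b i \<leadsto> c i | i. i \<in> I}"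
  have rs: "r \<in> carrier A" "s \<in> carrier A"
    using r s separator_subset by auto
  have P: "?P \<subseteq> carrier A" and Q: "?Q \<subseteq> carrier A"
    using b c rs by (auto intro!: arr_closed)
  have "r \<sqsubseteq> s \<leadsto> b i \<leadsto> c i" if "i \<in> I" for i
  proof -
    have carr: "a i \<in> carrier A" "b i \<leadsto> c i \<in> carrier A"
      using a b c that by (auto intro!: arr_closed)
    have "r \<sqsubseteq> a i \<leadsto> b i \<leadsto> c i"
      by (rule r(2)[OF that])
    also have "\<dots> \<sqsubseteq> s \<leadsto> b i \<leadsto> c i"
      using carr rs s(2)[OF that] by (intro arr_mono le_refl)
    finally show ?thesis
      using carr rs by (simp add: arr_closed)
  qed
  then have "realized A I (\<lambda>i. s \<leadsto> b i \<leadsto> c i)"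
    unfolding realized_def using r by blast
  then have "\<Sqinter> ?Q \<in> separator A"
    using b c rs by (subst realized_iff_Inf_in_separator) (auto intro!: arr_closed)
  moreover have "\<Sqinter> ?Q \<leadsto> s \<leadsto> \<Sqinter> ?P \<in> separator A"
    using comb_a_le_family[OF rs(2) b c] comb_a_in
    by (rule separator_upward[rotated 2]) (use rs P Q in \<open>auto intro!: arr_closed inf_closed\<close>)
  ultimately have "s \<leadsto> \<Sqinter> ?P \<in> separator A"
    using rs P Q by (intro separator_mp[of "\<Sqinter> ?Q" "s \<leadsto> \<Sqinter> ?P"] arr_closed inf_closed)
  then have "\<Sqinter> ?P \<in> separator A"
    using s rs P by (intro separator_mp[of s "\<Sqinter> ?P"] inf_closed)
  then show ?thesis
    using b c by (subst (asm) realized_iff_Inf_in_separator) (auto intro!: arr_closed)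
qed

lemma realized_k:
  assumes "a \<in> I \<rightarrow> carrier A" "b \<in> I \<rightarrow> carrier A"
  shows "realized A I (\<lambda>i. a i \<leadsto> b i \<leadsto> a i)"
  unfolding realized_def
proof (intro bexI[OF _ comb_k_in] ballI)
  fix i assume "i \<in> I"
  then have "a i \<in> carrier A" "b i \<in> carrier A"
    using assms by auto
  then show "comb_k A \<sqsubseteq> a i \<leadsto> b i \<leadsto> a i"
    unfolding comb_k_def by (intro inf_lower; blast intro!: arr_closed)
qed

lemma realized_s:
  assumes "a \<in> I \<rightarrow> carrier A" "b \<in> I \<rightarrow> carrier A" "c \<in> I \<rightarrow> carrier A"
  shows "realized A I (\<lambda>i. (a i \<leadsto> b i \<leadsto> c i) \<leadsto> (a i \<leadsto> b i) \<leadsto> a i \<leadsto> c i)"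
  unfolding realized_def
proof (intro bexI[OF _ comb_s_in] ballI)
  fix i assume "i \<in> I"
  then have "a i \<in> carrier A" "b i \<in> carrier A" "c i \<in> carrier A"
    using assms by auto
  then show "comb_s A \<sqsubseteq> (a i \<leadsto> b i \<leadsto> c i) \<leadsto> (a i \<leadsto> b i) \<leadsto> a i \<leadsto> c i"
    unfolding comb_s_def by (intro inf_lower; blast intro!: arr_closed)
qed

text \<open>The usual combinator \<open>s k k\<close> for the identity, whose intermediate types are
  \<open>a \<rightarrow> (a \<rightarrow> a) \<rightarrow> a\<close> and \<open>a \<rightarrow> a \<rightarrow> a\<close>.\<close>

lemma realized_refl:
  assumes a: "a \<in> I \<rightarrow> carrier A"
  shows "realized A I (\<lambda>i. a i \<leadsto> a i)"
proof -
  have aa: "(\<lambda>i. a i \<leadsto> a i) \<in> I \<rightarrow> carrier A" "(\<lambda>i. a i \<leadsto> a i \<leadsto> a i) \<in> I \<rightarrow> carrier A"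
      "(\<lambda>i. a i \<leadsto> (a i \<leadsto> a i) \<leadsto> a i) \<in> I \<rightarrow> carrier A"
    using a by (auto intro!: arr_closed)
  have "realized A I (\<lambda>i. (a i \<leadsto> a i \<leadsto> a i) \<leadsto> a i \<leadsto> a i)"
    by (rule realized_mp[OF aa(3,2,1) realized_s[OF a aa(1) a] realized_k[OF a aa(1)]])
  then show ?thesis
    by (rule realized_mp[OF aa(2) a a _ realized_k[OF a a]])
qed

text \<open>Composition: \<open>k\<close> turns \<open>b \<rightarrow> c\<close> into \<open>a \<rightarrow> b \<rightarrow> c\<close>, to which \<open>s\<close> applies.\<close>

lemma realized_trans:
  assumes a: "a \<in> I \<rightarrow> carrier A" and b: "b \<in> I \<rightarrow> carrier A" and c: "c \<in> I \<rightarrow> carrier A"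
    and ab: "realized A I (\<lambda>i. a i \<leadsto> b i)" and bc: "realized A I (\<lambda>i. b i \<leadsto> c i)"
  shows "realized A I (\<lambda>i. a i \<leadsto> c i)"
proof -
  have carr: "(\<lambda>i. a i \<leadsto> b i) \<in> I \<rightarrow> carrier A" "(\<lambda>i. b i \<leadsto> c i) \<in> I \<rightarrow> carrier A"
      "(\<lambda>i. a i \<leadsto> c i) \<in> I \<rightarrow> carrier A" "(\<lambda>i. a i \<leadsto> b i \<leadsto> c i) \<in> I \<rightarrow> carrier A"
    using a b c by (simp_all add: arr_closed Pi_iff)
  have "realized A I (\<lambda>i. a i \<leadsto> b i \<leadsto> c i)"
    by (rule realized_mp[OF carr(2) a carr(2) realized_k[OF carr(2) a] bc])
  then have "realized A I (\<lambda>i. (a i \<leadsto> b i) \<leadsto> a i \<leadsto> c i)"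
    by (rule realized_mp[OF carr(4,1,3) realized_s[OF a b c]])
  then show ?thesis
    by (rule realized_mp[OF carr(1) a c _ ab])
qed

end


section \<open>The preorder-enriched category of arrow algebras\<close>

lemma entails_iff_realized:
  assumes "arrow_algebra B" "f \<in> carrier A \<rightarrow> carrier B" "f' \<in> carrier A \<rightarrow> carrier B"
  shows "entails A B f f' \<longleftrightarrow> realized B (carrier A) (\<lambda>a. f a \<leadsto>\<^bsub>B\<^esub> f' a)"
proof -
  interpret B: arrow_algebra B by fact
  show ?thesis
    unfolding entails_def
    by (rule B.realized_iff_Inf_in_separator) (use assms in \<open>auto intro!: B.arr_closed\<close>)
qed

lemma implicative_morphism_iff_realized:
  assumes A: "arrow_algebra A" and B: "arrow_algebra B"
  shows "implicative_morphism A B f \<longleftrightarrow>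
     f \<in> carrier A \<rightarrow>\<^sub>E carrier B \<and>
     (\<forall>a\<in>separator A. f a \<in> separator B) \<and>
     realized B (carrier A \<times> carrier A) (\<lambda>p. f (fst p \<leadsto>\<^bsub>A\<^esub> snd p) \<leadsto>\<^bsub>B\<^esub> f (fst p) \<leadsto>\<^bsub>B\<^esub> f (snd p)) \<and>
     (\<forall>X \<subseteq> carrier A \<times> carrier A.
        realized A X (\<lambda>p. fst p \<leadsto>\<^bsub>A\<^esub> snd p) \<longrightarrow> realized B X (\<lambda>p. f (fst p) \<leadsto>\<^bsub>B\<^esub> f (snd p)))"
proof -
  interpret A: arrow_algebra A by fact
  interpret B: arrow_algebra B by fact
  show ?thesis
  proof (cases "f \<in> carrier A \<rightarrow>\<^sub>E carrier B")
    case True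
    have A_iff: "\<Sqinter>\<^bsub>A\<^esub> {a \<leadsto>\<^bsub>A\<^esub> a' | a a'. (a, a') \<in> X} \<in> separator A \<longleftrightarrow>
        realized A X (\<lambda>p. fst p \<leadsto>\<^bsub>A\<^esub> snd p)"
      if X: "X \<subseteq> carrier A \<times> carrier A" for X
    proof (rule A.realized_iff_Inf_in_separator)
      show "(\<lambda>p. fst p \<leadsto>\<^bsub>A\<^esub> snd p) \<in> X \<rightarrow> carrier A"
        using X by (auto intro!: A.arr_closed)
    qed (simp add: image_def Bex_def split_paired_Ex conj_commute)
    have B_iff: "\<Sqinter>\<^bsub>B\<^esub> {f a \<leadsto>\<^bsub>B\<^esub> f a' | a a'. (a, a') \<in> X} \<in> separator B \<longleftrightarrow>
        realized B X (\<lambda>p. f (fst p) \<leadsto>\<^bsub>B\<^esub> f (snd p))"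
      if X: "X \<subseteq> carrier A \<times> carrier A" for X
    proof (rule B.realized_iff_Inf_in_separator)
      show "(\<lambda>p. f (fst p) \<leadsto>\<^bsub>B\<^esub> f (snd p)) \<in> X \<rightarrow> carrier B"
        using X True by (auto intro!: B.arr_closed)
    qed (simp add: image_def Bex_def split_paired_Ex conj_commute)
    have uniform: "(\<exists>r\<in>separator B. \<forall>a\<in>carrier A. \<forall>a'\<in>carrier A.
          r \<sqsubseteq>\<^bsub>B\<^esub> f (a \<leadsto>\<^bsub>A\<^esub> a') \<leadsto>\<^bsub>B\<^esub> f a \<leadsto>\<^bsub>B\<^esub> f a') \<longleftrightarrow>
        realized B (carrier A \<times> carrier A)
          (\<lambda>p. f (fst p \<leadsto>\<^bsub>A\<^esub> snd p) \<leadsto>\<^bsub>B\<^esub> f (fst p) \<leadsto>\<^bsub>B\<^esub> f (snd p))"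
      unfolding realized_def by auto
    show ?thesis
      using True unfolding implicative_morphism_def uniform by (simp add: A_iff B_iff)
  qed (simp add: implicative_morphism_def)
qed

text \<open>The third condition on implicative morphisms concerns sets of pairs; a family of pairs enters
  it through its range.\<close>

lemma implicative_morphism_realized:
  assumes A: "arrow_algebra A" and B: "arrow_algebra B" and f: "implicative_morphism A B f"
    and u: "u \<in> I \<rightarrow> carrier A" and v: "v \<in> I \<rightarrow> carrier A"
    and uv: "realized A I (\<lambda>i. u i \<leadsto>\<^bsub>A\<^esub> v i)"
  shows "realized B I (\<lambda>i. f (u i) \<leadsto>\<^bsub>B\<^esub> f (v i))"
proof -
  let ?X = "(\<lambda>i. (u i, v i)) ` I"
  have "?X \<subseteq> carrier A \<times> carrier A"
    using u v by auto
  moreover have "realized A ?X (\<lambda>p. fst p \<leadsto>\<^bsub>A\<^esub> snd p)"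
    using uv unfolding realized_def by auto
  ultimately have "realized B ?X (\<lambda>p. f (fst p) \<leadsto>\<^bsub>B\<^esub> f (snd p))"
    using f unfolding implicative_morphism_iff_realized[OF A B] by blast
  then show ?thesis
    unfolding realized_def by auto
qed

lemma implicative_morphism_funcset:
  "implicative_morphism A B f \<Longrightarrow> f \<in> carrier A \<rightarrow> carrier B"
  unfolding implicative_morphism_def by auto

lemma implicative_morphism_id:
  assumes A: "arrow_algebra A"
  shows "implicative_morphism A A (\<lambda>x\<in>carrier A. x)"
proof -
  interpret A: arrow_algebra A by fact
  let ?I = "carrier A \<times> carrier A" and ?id = "\<lambda>x\<in>carrier A. x"
  have refl: "realized A ?I (\<lambda>p. (fst p \<leadsto>\<^bsub>A\<^esub> snd p) \<leadsto>\<^bsub>A\<^esub> (fst p \<leadsto>\<^bsub>A\<^esub> snd p))"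
    by (rule A.realized_refl) (auto intro!: A.arr_closed)
  show ?thesis
    unfolding implicative_morphism_iff_realized[OF A A]
  proof (intro conjI ballI allI impI)
    show "?id a \<in> separator A" if "a \<in> separator A" for a
      using that A.separator_subset by auto
    show "realized A ?I (\<lambda>p. ?id (fst p \<leadsto>\<^bsub>A\<^esub> snd p) \<leadsto>\<^bsub>A\<^esub> ?id (fst p) \<leadsto>\<^bsub>A\<^esub> ?id (snd p))"
      using refl by (rule realized_cong[THEN iffD1, rotated]) (auto simp: A.arr_closed)
    show "realized A X (\<lambda>p. ?id (fst p) \<leadsto>\<^bsub>A\<^esub> ?id (snd p))"
      if "X \<subseteq> ?I" "realized A X (\<lambda>p. fst p \<leadsto>\<^bsub>A\<^esub> snd p)" for X
      using that(2) by (rule realized_cong[THEN iffD1, rotated]) (use that(1) in auto)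
  qed auto
qed

lemma implicative_morphism_compose:
  assumes A: "arrow_algebra A" and B: "arrow_algebra B" and C: "arrow_algebra C"
    and f: "implicative_morphism A B f" and g: "implicative_morphism B C g"
  shows "implicative_morphism A C (compose (carrier A) g f)"
proof -
  interpret A: arrow_algebra A by fact
  interpret B: arrow_algebra B by fact
  interpret C: arrow_algebra C by fact
  have fc: "a \<in> carrier A \<Longrightarrow> f a \<in> carrier B" and gc: "b \<in> carrier B \<Longrightarrow> g b \<in> carrier C" for a b
    using f g implicative_morphism_funcset by blast+
  let ?I = "carrier A \<times> carrier A"
  \<comment> \<open>The second condition for \<open>g f\<close> follows in two steps, from \<open>g (f (a \<rightarrow> a'))\<close> to
    \<open>g (f a \<rightarrow> f a')\<close> by the second condition for \<open>f\<close> and the third for \<open>g\<close>, and from there to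
    \<open>g (f a) \<rightarrow> g (f a')\<close> by the second condition for \<open>g\<close>.\<close>
  have "realized B ?I (\<lambda>p. f (fst p \<leadsto>\<^bsub>A\<^esub> snd p) \<leadsto>\<^bsub>B\<^esub> f (fst p) \<leadsto>\<^bsub>B\<^esub> f (snd p))"
    using f unfolding implicative_morphism_iff_realized[OF A B] by blast
  then have 1: "realized C ?I (\<lambda>p. g (f (fst p \<leadsto>\<^bsub>A\<^esub> snd p)) \<leadsto>\<^bsub>C\<^esub> g (f (fst p) \<leadsto>\<^bsub>B\<^esub> f (snd p)))"
    by (intro implicative_morphism_realized[OF B C g]) (auto intro!: A.arr_closed B.arr_closed fc)
  have "realized C (carrier B \<times> carrier B)
      (\<lambda>p. g (fst p \<leadsto>\<^bsub>B\<^esub> snd p) \<leadsto>\<^bsub>C\<^esub> g (fst p) \<leadsto>\<^bsub>C\<^esub> g (snd p))"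
    using g unfolding implicative_morphism_iff_realized[OF B C] by blast
  from realized_reindex[OF this, of "\<lambda>p. (f (fst p), f (snd p))" ?I]
  have 2: "realized C ?I (\<lambda>p. g (f (fst p) \<leadsto>\<^bsub>B\<^esub> f (snd p)) \<leadsto>\<^bsub>C\<^esub> g (f (fst p)) \<leadsto>\<^bsub>C\<^esub> g (f (snd p)))"
    using fc by (simp add: Pi_iff mem_Times_iff)
  have 3: "realized C ?I (\<lambda>p. g (f (fst p \<leadsto>\<^bsub>A\<^esub> snd p)) \<leadsto>\<^bsub>C\<^esub> g (f (fst p)) \<leadsto>\<^bsub>C\<^esub> g (f (snd p)))"
    by (rule C.realized_trans[OF _ _ _ 1 2]) (auto intro!: A.arr_closed B.arr_closed C.arr_closed fc gc)
  have 4: "realized C X (\<lambda>p. g (f (fst p)) \<leadsto>\<^bsub>C\<^esub> g (f (snd p)))"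
    if "X \<subseteq> ?I" "realized A X (\<lambda>p. fst p \<leadsto>\<^bsub>A\<^esub> snd p)" for X
    using that fc
    by (intro implicative_morphism_realized[OF B C g] implicative_morphism_realized[OF A B f]) auto
  have 5: "g (f a) \<in> separator C" if "a \<in> separator A" for a
    using that f g unfolding implicative_morphism_def by blast
  show ?thesis
    unfolding implicative_morphism_iff_realized[OF A C]
  proof (intro conjI ballI allI impI)
    show "compose (carrier A) g f \<in> carrier A \<rightarrow>\<^sub>E carrier C"
      using fc gc by (auto simp: compose_def)
    show "compose (carrier A) g f a \<in> separator C" if "a \<in> separator A" for a
      using that 5 A.separator_subset by (auto simp: compose_def)
    show "realized C ?I (\<lambda>p. compose (carrier A) g f (fst p \<leadsto>\<^bsub>A\<^esub> snd p) \<leadsto>\<^bsub>C\<^esub>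
        compose (carrier A) g f (fst p) \<leadsto>\<^bsub>C\<^esub> compose (carrier A) g f (snd p))"
      using 3 by (rule realized_cong[THEN iffD1, rotated]) (auto simp: compose_def A.arr_closed)
    show "realized C X (\<lambda>p. compose (carrier A) g f (fst p) \<leadsto>\<^bsub>C\<^esub> compose (carrier A) g f (snd p))"
      if "X \<subseteq> ?I" "realized A X (\<lambda>p. fst p \<leadsto>\<^bsub>A\<^esub> snd p)" for X
      using 4[OF that]
      by (rule realized_cong[THEN iffD1, rotated]) (use that(1) in \<open>auto simp: compose_def\<close>)
  qed
qed

lemma entails_refl:
  assumes "arrow_algebra B" "f \<in> carrier A \<rightarrow> carrier B"
  shows "entails A B f f"
  using assms arrow_algebra.realized_refl[of B] by (simp add: entails_iff_realized)

lemma entails_trans: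
  assumes "arrow_algebra B" "f \<in> carrier A \<rightarrow> carrier B" "g \<in> carrier A \<rightarrow> carrier B"
    "h \<in> carrier A \<rightarrow> carrier B" "entails A B f g" "entails A B g h"
  shows "entails A B f h"
  using assms arrow_algebra.realized_trans[of B f "carrier A" g h]
  by (simp add: entails_iff_realized)

lemma compose_funcset:
  assumes "f \<in> A \<rightarrow> B" "g \<in> B \<rightarrow> C"
  shows "compose A g f \<in> A \<rightarrow> C"
  using assms by (auto simp: compose_def)

lemma entails_postcompose:
  assumes B: "arrow_algebra B" and C: "arrow_algebra C"
    and f: "f \<in> carrier A \<rightarrow> carrier B" and f': "f' \<in> carrier A \<rightarrow> carrier B"
    and g: "implicative_morphism B C g" and ff': "entails A B f f'"
  shows "entails A C (compose (carrier A) g f) (compose (carrier A) g f')"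
proof -
  have "realized C (carrier A) (\<lambda>a. g (f a) \<leadsto>\<^bsub>C\<^esub> g (f' a))"
    using ff' unfolding entails_iff_realized[OF B f f']
    by (intro implicative_morphism_realized[OF B C g f f'])
  then show ?thesis
    using compose_funcset[OF f implicative_morphism_funcset[OF g]]
      compose_funcset[OF f' implicative_morphism_funcset[OF g]]
    by (simp add: entails_iff_realized[OF C] compose_def cong: realized_cong)
qed

lemma entails_precompose:
  assumes C: "arrow_algebra C" and f: "f \<in> carrier A \<rightarrow> carrier B"
    and g: "g \<in> carrier B \<rightarrow> carrier C" and g': "g' \<in> carrier B \<rightarrow> carrier C"
    and gg': "entails B C g g'"
  shows "entails A C (compose (carrier A) g f) (compose (carrier A) g' f)"
proof -
  have "realized C (carrier A) (\<lambda>a. g (f a) \<leadsto>\<^bsub>C\<^esub> g' (f a))"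
    using gg' unfolding entails_iff_realized[OF C g g'] by (rule realized_reindex[OF _ f])
  then show ?thesis
    using compose_funcset[OF f g] compose_funcset[OF f g']
    by (simp add: entails_iff_realized[OF C] compose_def cong: realized_cong)
qed

lemma computationally_dense_iff_realized:
  assumes A: "arrow_algebra A" and B: "arrow_algebra B" and f: "f \<in> carrier A \<rightarrow> carrier B"
  shows "computationally_dense A B f \<longleftrightarrow> (\<exists>h. implicative_morphism B A h \<and>
     realized B (carrier B) (\<lambda>b. f (h b) \<leadsto>\<^bsub>B\<^esub> b) \<and>
     realized A (carrier A) (\<lambda>a. a \<leadsto>\<^bsub>A\<^esub> h (f a)))"
proof -
  have "entails B B (compose (carrier B) f h) (\<lambda>x\<in>carrier B. x) \<longleftrightarrow>
        realized B (carrier B) (\<lambda>b. f (h b) \<leadsto>\<^bsub>B\<^esub> b)"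
    and "entails A A (\<lambda>x\<in>carrier A. x) (compose (carrier A) h f) \<longleftrightarrow>
        realized A (carrier A) (\<lambda>a. a \<leadsto>\<^bsub>A\<^esub> h (f a))"
    if h: "implicative_morphism B A h" for h
  proof -
    note h' = implicative_morphism_funcset[OF h]
    show "entails B B (compose (carrier B) f h) (\<lambda>x\<in>carrier B. x) \<longleftrightarrow>
        realized B (carrier B) (\<lambda>b. f (h b) \<leadsto>\<^bsub>B\<^esub> b)"
      using compose_funcset[OF h' f]
      by (simp add: entails_iff_realized[OF B] compose_def cong: realized_cong)
    show "entails A A (\<lambda>x\<in>carrier A. x) (compose (carrier A) h f) \<longleftrightarrow>
        realized A (carrier A) (\<lambda>a. a \<leadsto>\<^bsub>A\<^esub> h (f a))"
      using compose_funcset[OF f h']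
      by (simp add: entails_iff_realized[OF A] compose_def cong: realized_cong)
  qed
  then show ?thesis
    unfolding computationally_dense_def by (simp cong: conj_cong)
qed

text \<open>Adjoints compose: if \<open>h\<close> and \<open>k\<close> witness the density of \<open>f\<close> and \<open>g\<close>, then \<open>h k\<close> witnesses that of
  \<open>g f\<close>, by \<open>g f h k \<turnstile> g k \<turnstile> id\<close> and \<open>id \<turnstile> h f \<turnstile> h k g f\<close>.\<close>

lemma computationally_dense_compose:
  assumes A: "arrow_algebra A" and B: "arrow_algebra B" and C: "arrow_algebra C"
    and f: "implicative_morphism A B f" and g: "implicative_morphism B C g"
    and df: "computationally_dense A B f" and dg: "computationally_dense B C g"
  shows "computationally_dense A C (compose (carrier A) g f)"
proof -
  note f' = implicative_morphism_funcset[OF f] and g' = implicative_morphism_funcset[OF g]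
  obtain h where h: "implicative_morphism B A h"
    and fh: "realized B (carrier B) (\<lambda>b. f (h b) \<leadsto>\<^bsub>B\<^esub> b)"
    and hf: "realized A (carrier A) (\<lambda>a. a \<leadsto>\<^bsub>A\<^esub> h (f a))"
    using df unfolding computationally_dense_iff_realized[OF A B f'] by blast
  obtain k where k: "implicative_morphism C B k"
    and gk: "realized C (carrier C) (\<lambda>c. g (k c) \<leadsto>\<^bsub>C\<^esub> c)"
    and kg: "realized B (carrier B) (\<lambda>b. b \<leadsto>\<^bsub>B\<^esub> k (g b))"
    using dg unfolding computationally_dense_iff_realized[OF B C g'] by blast
  note h' = implicative_morphism_funcset[OF h] and k' = implicative_morphism_funcset[OF k]
  note carr = funcset_mem[OF f'] funcset_mem[OF g'] funcset_mem[OF h'] funcset_mem[OF k']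
  have gfhk: "realized C (carrier C) (\<lambda>c. g (f (h (k c))) \<leadsto>\<^bsub>C\<^esub> g (k c))"
    by (rule implicative_morphism_realized[OF B C g _ _ realized_reindex[OF fh k']])
      (simp_all add: carr)
  have 1: "realized C (carrier C) (\<lambda>c. g (f (h (k c))) \<leadsto>\<^bsub>C\<^esub> c)"
    by (rule arrow_algebra.realized_trans[OF C _ _ _ gfhk gk]) (simp_all add: carr)
  have hkgf: "realized A (carrier A) (\<lambda>a. h (f a) \<leadsto>\<^bsub>A\<^esub> h (k (g (f a))))"
    by (rule implicative_morphism_realized[OF B A h _ _ realized_reindex[OF kg f']])
      (simp_all add: carr)
  have 2: "realized A (carrier A) (\<lambda>a. a \<leadsto>\<^bsub>A\<^esub> h (k (g (f a))))"
    by (rule arrow_algebra.realized_trans[OF A _ _ _ hf hkgf]) (simp_all add: carr)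
  show ?thesis
    unfolding computationally_dense_iff_realized[OF A C compose_funcset[OF f' g']]
  proof (intro exI conjI)
    show "implicative_morphism C A (compose (carrier C) h k)"
      by (rule implicative_morphism_compose[OF C B A k h])
    show "realized C (carrier C)
        (\<lambda>c. compose (carrier A) g f (compose (carrier C) h k c) \<leadsto>\<^bsub>C\<^esub> c)"
      using 1 by (simp add: compose_def carr cong: realized_cong)
    show "realized A (carrier A)
        (\<lambda>a. a \<leadsto>\<^bsub>A\<^esub> compose (carrier C) h k (compose (carrier A) g f a))"
      using 2 by (simp add: compose_def carr cong: realized_cong)
  qed
qed

lemma cd_morphisms_funcset: "f \<in> cd_morphisms A B \<Longrightarrow> f \<in> carrier A \<rightarrow> carrier B"
  unfolding cd_morphisms_def by (simp add: implicative_morphism_funcset)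

lemma cd_morphisms_extensional: "f \<in> cd_morphisms A B \<Longrightarrow> f \<in> extensional (carrier A)"
  unfolding cd_morphisms_def implicative_morphism_def by (auto simp: PiE_def)

lemma cd_morphisms_id:
  assumes A: "arrow_algebra A"
  shows "(\<lambda>x\<in>carrier A. x) \<in> cd_morphisms A A"
proof -
  note id = implicative_morphism_id[OF A]
  have "realized A (carrier A) (\<lambda>a. a \<leadsto>\<^bsub>A\<^esub> a)"
    by (rule arrow_algebra.realized_refl[OF A]) simp
  then have "computationally_dense A A (\<lambda>x\<in>carrier A. x)"
    unfolding computationally_dense_iff_realized[OF A A implicative_morphism_funcset[OF id]]
    by (intro exI[of _ "\<lambda>x\<in>carrier A. x"] conjI id) (simp_all cong: realized_cong)
  then show ?thesis
    unfolding cd_morphisms_def using id by simp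
qed

lemma cd_morphisms_compose:
  assumes "arrow_algebra A" "arrow_algebra B" "arrow_algebra C"
    and "f \<in> cd_morphisms A B" "g \<in> cd_morphisms B C"
  shows "compose (carrier A) g f \<in> cd_morphisms A C"
  using assms unfolding cd_morphisms_def
  by (simp add: implicative_morphism_compose computationally_dense_compose)

lemma entails_compose:
  assumes "arrow_algebra B" "arrow_algebra C"
    and "f \<in> cd_morphisms A B" "f' \<in> cd_morphisms A B"
    and "g \<in> cd_morphisms B C" "g' \<in> cd_morphisms B C"
    and "entails A B f f'" "entails B C g g'"
  shows "entails A C (compose (carrier A) g f) (compose (carrier A) g' f')"
proof -
  note maps = assms(3-6)[THEN cd_morphisms_funcset]
  have "implicative_morphism B C g"
    using assms(5) by (simp add: cd_morphisms_def)
  from entails_postcompose[OF assms(1,2) maps(1,2) this assms(7)]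
    entails_precompose[OF assms(2) maps(2-4) assms(8)]
  show ?thesis
    by (rule entails_trans[OF assms(2) compose_funcset[OF maps(1,3)] compose_funcset[OF maps(2,3)]
          compose_funcset[OF maps(2,4)]])
qed

lemma preorder_enriched_category_ArrAlg_cd: "preorder_enriched_category ArrAlg_cd"
proof (unfold_locales, goal_cases)
  case 1 then show ?case
    by (simp add: ArrAlg_cd_def cd_morphisms_id)
next
  case 2 then show ?case
    by (simp add: ArrAlg_cd_def cd_morphisms_compose)
next
  case (3 A B f) then show ?case
    using Id_compose[of f "carrier A" "carrier B"] cd_morphisms_funcset[of f A B]
      cd_morphisms_extensional[of f A B]
    by (simp add: ArrAlg_cd_def)
next
  case (4 A B f) then show ?case
    using compose_Id[of f "carrier A" "carrier B"] cd_morphisms_funcset[of f A B]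
      cd_morphisms_extensional[of f A B]
    by (simp add: ArrAlg_cd_def)
next
  case (5 A B C D f g h) then show ?case
    using compose_assoc[of f "carrier A" "carrier B" h g] cd_morphisms_funcset[of f A B]
    by (simp add: ArrAlg_cd_def)
next
  case 6 then show ?case
    by (simp add: ArrAlg_cd_def entails_refl cd_morphisms_funcset)
next
  case (7 A B f g h) then show ?case
    using entails_trans[of B f A g h] by (auto simp: ArrAlg_cd_def dest: cd_morphisms_funcset)
next
  case 8 then show ?case
    by (simp add: ArrAlg_cd_def entails_compose)
qed


section \<open>Frames as arrow algebras\<close>

lemma inf_frame_arrow_algebra [simp]: "\<Sqinter>\<^bsub>frame_arrow_algebra L\<^esub> X = \<Sqinter>\<^bsub>L\<^esub> X"
  by (simp add: inf_def greatest_def Lower_def)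

context frame
begin

lemma heyting_imp_closed [simp]: "heyting_imp L a b \<in> carrier L"
  unfolding heyting_imp_def by (rule sup_closed) auto

lemma le_heyting_impI:
  "x \<sqinter> a \<sqsubseteq> b \<Longrightarrow> a \<in> carrier L \<Longrightarrow> b \<in> carrier L \<Longrightarrow> x \<in> carrier L \<Longrightarrow> x \<sqsubseteq> heyting_imp L a b"
  by (simp add: heyting_imp_adjoint)

lemma le_heyting_impD:
  "x \<sqsubseteq> heyting_imp L a b \<Longrightarrow> y \<sqsubseteq> x \<Longrightarrow> y \<sqsubseteq> a \<Longrightarrow> a \<in> carrier L \<Longrightarrow> b \<in> carrier L \<Longrightarrow>
    x \<in> carrier L \<Longrightarrow> y \<in> carrier L \<Longrightarrow> y \<sqsubseteq> b"
  by (meson heyting_imp_adjoint le_trans meet_closed meet_le)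

lemma eq_top_iff: "x \<in> carrier L \<Longrightarrow> x = \<top> \<longleftrightarrow> \<top> \<sqsubseteq> x"
  using le_antisym top_closed top_higher by blast

lemma heyting_imp_eq_top_iff:
  assumes "a \<in> carrier L" "b \<in> carrier L"
  shows "heyting_imp L a b = \<top> \<longleftrightarrow> a \<sqsubseteq> b"
proof -
  have "\<top> \<sqinter> a = a"
    using assms by (intro le_antisym meet_right meet_le) auto
  then show ?thesis
    using assms by (simp add: eq_top_iff heyting_imp_adjoint)
qed

lemma inf_eq_topI:
  assumes top: "\<And>x. x \<in> X \<Longrightarrow> x = \<top>"
  shows "\<Sqinter> X = \<top>"
proof -
  have X: "X \<subseteq> carrier L"
    using top by auto
  have "\<top> \<sqsubseteq> \<Sqinter> X"
  proof (rule inf_greatest[OF X])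
    show "\<top> \<sqsubseteq> x" if "x \<in> X" for x
      unfolding top[OF that] by simp
  qed simp
  then show ?thesis
    using X by (simp add: eq_top_iff)
qed

lemma inf_insert_meet:
  "x \<in> carrier L \<Longrightarrow> X \<subseteq> carrier L \<Longrightarrow> \<Sqinter> (insert x X) = x \<sqinter> \<Sqinter> X"
  using weak_inf_insert unfolding eq_is_equal .

lemma heyting_imp_mono:
  assumes "a' \<sqsubseteq> a" "b \<sqsubseteq> b'"
    and c: "a \<in> carrier L" "a' \<in> carrier L" "b \<in> carrier L" "b' \<in> carrier L"
  shows "heyting_imp L a b \<sqsubseteq> heyting_imp L a' b'"
proof (rule le_heyting_impI)
  let ?h = "heyting_imp L a b" and ?x = "heyting_imp L a b \<sqinter> a'"
  have x: "?x \<in> carrier L" "?x \<sqsubseteq> ?h" "?x \<sqsubseteq> a'"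
    using c by (auto intro: meet_left meet_right)
  then have "?x \<sqsubseteq> a"
    using assms by (meson le_trans)
  then have "?x \<sqsubseteq> b"
    using le_heyting_impD[OF le_refl x(2)] x c heyting_imp_closed by blast
  then show "?x \<sqsubseteq> b'"
    using assms x by (meson le_trans)
qed (use c in auto)

text \<open>In a frame each instance of the three combinators is an intuitionistic tautology, so its value
  is \<open>\<top>\<close>, and hence so is the meet of all instances.\<close>

lemma heyting_imp_k:
  "a \<in> carrier L \<Longrightarrow> b \<in> carrier L \<Longrightarrow> heyting_imp L a (heyting_imp L b a) = \<top>"
  by (simp add: heyting_imp_eq_top_iff heyting_imp_adjoint meet_left)

text \<open>The meet of the two premises and \<open>a\<close> lies below \<open>b \<rightarrow> c\<close> and below \<open>b\<close>.\<close>

lemma heyting_imp_s: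
  assumes c: "a \<in> carrier L" "b \<in> carrier L" "c \<in> carrier L"
  shows "heyting_imp L (heyting_imp L a (heyting_imp L b c))
    (heyting_imp L (heyting_imp L a b) (heyting_imp L a c)) = \<top>"
proof -
  let ?p = "heyting_imp L a (heyting_imp L b c)" and ?q = "heyting_imp L a b"
  let ?x = "?p \<sqinter> ?q \<sqinter> a"
  have x: "?x \<in> carrier L" "?x \<sqsubseteq> ?p \<sqinter> ?q" "?x \<sqsubseteq> a"
    using c by (auto intro: meet_left meet_right)
  then have "?x \<sqsubseteq> ?p" "?x \<sqsubseteq> ?q"
    by (meson heyting_imp_closed le_trans meet_closed meet_left meet_right)+
  then have "?x \<sqsubseteq> heyting_imp L b c" "?x \<sqsubseteq> b"
    using le_heyting_impD x c by auto
  then have "?x \<sqsubseteq> c"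
    using le_heyting_impD[OF le_refl] x c by auto
  then show ?thesis
    using c by (simp add: heyting_imp_eq_top_iff heyting_imp_adjoint)
qed

text \<open>Implication by \<open>a\<close> is a right adjoint and so commutes with meets.\<close>

lemma heyting_imp_a:
  assumes a: "a \<in> carrier L" and X: "X \<subseteq> carrier L \<times> carrier L"
  shows "heyting_imp L (\<Sqinter> {heyting_imp L a (heyting_imp L b c) | b c. (b, c) \<in> X})
    (heyting_imp L a (\<Sqinter> {heyting_imp L b c | b c. (b, c) \<in> X})) = \<top>"
proof -
  let ?P = "{heyting_imp L a (heyting_imp L b c) | b c. (b, c) \<in> X}"
  let ?Q = "{heyting_imp L b c | b c. (b, c) \<in> X}"
  have P: "?P \<subseteq> carrier L" and Q: "?Q \<subseteq> carrier L"
    by auto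
  let ?x = "\<Sqinter> ?P \<sqinter> a"
  have x: "?x \<in> carrier L" "?x \<sqsubseteq> \<Sqinter> ?P" "?x \<sqsubseteq> a"
    using a P by (auto intro: meet_left meet_right)
  have "?x \<sqsubseteq> heyting_imp L b c" if "(b, c) \<in> X" for b c
  proof -
    have "?x \<sqsubseteq> heyting_imp L a (heyting_imp L b c)"
      using that x P by (intro le_trans[OF x(2) inf_lower[OF P]]) auto
    then show ?thesis
      using le_heyting_impD[OF le_refl] x a by auto
  qed
  then have "?x \<sqsubseteq> \<Sqinter> ?Q"
    using x Q by (intro inf_greatest) auto
  then show ?thesis
    using a P Q by (simp add: heyting_imp_eq_top_iff heyting_imp_adjoint)
qed

end

lemma arrow_algebra_frame:
  assumes L: "frame L"
  shows "arrow_algebra (frame_arrow_algebra L)"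
proof -
  interpret frame L by fact
  interpret F: partial_order "frame_arrow_algebra L"
    by unfold_locales (auto simp: eq_is_equal intro: le_trans)
  show ?thesis
  \<comment> \<open>Cases 1 to 3 concern meets and implication, case 6 modus ponens for \<open>{\<top>}\<close>, cases 7 to 9 the
    three combinators.\<close>
  proof (unfold_locales, goal_cases)
    case 1 then show ?case
      using inf_exists by (simp add: greatest_def Lower_def)
  next
    case 2 then show ?case by simp
  next
    case 3 then show ?case by (simp add: heyting_imp_mono)
  next
    case 7 then show ?case
      unfolding comb_k_def by (auto intro!: inf_eq_topI simp: heyting_imp_k)
  next
    case 8 then show ?case
      unfolding comb_s_def by (auto intro!: inf_eq_topI simp: heyting_imp_s)
  next
    case 9 then show ?case
      unfolding comb_a_def by (auto intro!: inf_eq_topI simp: heyting_imp_a)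
  next
    case (6 a b)
    then show ?case
      using heyting_imp_eq_top_iff[of a b] eq_top_iff[of b] by auto
  qed (auto simp: eq_top_iff)
qed

lemma realized_frame_iff:
  assumes "frame L" "u \<in> I \<rightarrow> carrier L"
  shows "realized (frame_arrow_algebra L) I u \<longleftrightarrow> (\<forall>i\<in>I. u i = \<top>\<^bsub>L\<^esub>)"
proof -
  interpret frame L by fact
  show ?thesis
    using assms(2) unfolding realized_def by (auto simp: eq_top_iff Pi_iff)
qed

lemma realized_heyting_imp_iff:
  assumes "frame L" "a \<in> I \<rightarrow> carrier L" "b \<in> I \<rightarrow> carrier L"
  shows "realized (frame_arrow_algebra L) I (\<lambda>i. heyting_imp L (a i) (b i))
    \<longleftrightarrow> (\<forall>i\<in>I. a i \<sqsubseteq>\<^bsub>L\<^esub> b i)"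
proof -
  interpret frame L by fact
  show ?thesis
    using assms
    by (subst realized_frame_iff) (auto simp: heyting_imp_eq_top_iff Pi_iff)
qed

lemma entails_frame_iff:
  assumes L: "frame L" and M: "frame M"
    and f: "f \<in> carrier L \<rightarrow> carrier M" and f': "f' \<in> carrier L \<rightarrow> carrier M"
  shows "entails (frame_arrow_algebra L) (frame_arrow_algebra M) f f' \<longleftrightarrow> pointwise_le L M f f'"
  using entails_iff_realized[OF arrow_algebra_frame[OF M], of f "frame_arrow_algebra L" f']
    realized_heyting_imp_iff[OF M f f'] f f'
  by (simp add: pointwise_le_def)

lemma (in frame) meet_preserving_mono:
  assumes "f \<in> carrier L \<rightarrow> carrier M" "frame M"
    and "\<forall>a\<in>carrier L. \<forall>b\<in>carrier L. f (a \<sqinter> b) = f a \<sqinter>\<^bsub>M\<^esub> f b"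
    and "a \<in> carrier L" "b \<in> carrier L" "a \<sqsubseteq> b"
  shows "f a \<sqsubseteq>\<^bsub>M\<^esub> f b"
proof -
  interpret M: frame M by fact
  have "a = a \<sqinter> b"
    using assms by (intro le_antisym meet_le meet_left) auto
  then show ?thesis
    using assms M.meet_right by (metis Pi_mem)
qed

text \<open>Preservation of binary meets is equivalent to monotonicity together with
  \<open>f (a \<rightarrow> b) \<le> f a \<rightarrow> f b\<close>. In one direction, \<open>a \<le> b \<rightarrow> (a \<sqinter> b)\<close> gives
  \<open>f a \<le> f b \<rightarrow> f (a \<sqinter> b)\<close>, which is the nontrivial half of the equation; in the other, \<open>f\<close> is applied
  to \<open>(a \<rightarrow> b) \<sqinter> a \<le> b\<close>.\<close>

lemma implicative_morphism_frame_iff: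
  assumes L: "frame L" and M: "frame M"
  shows "implicative_morphism (frame_arrow_algebra L) (frame_arrow_algebra M) f \<longleftrightarrow>
     f \<in> carrier L \<rightarrow>\<^sub>E carrier M \<and> f \<top>\<^bsub>L\<^esub> = \<top>\<^bsub>M\<^esub> \<and>
     (\<forall>a\<in>carrier L. \<forall>b\<in>carrier L. f (a \<sqinter>\<^bsub>L\<^esub> b) = f a \<sqinter>\<^bsub>M\<^esub> f b)"
    (is "?impl \<longleftrightarrow> ?meet")
proof -
  interpret L: frame L by fact
  interpret M: frame M by fact
  have "?impl \<longleftrightarrow> f \<in> carrier L \<rightarrow>\<^sub>E carrier M \<and> f \<top>\<^bsub>L\<^esub> = \<top>\<^bsub>M\<^esub> \<and>
     (\<forall>a\<in>carrier L. \<forall>b\<in>carrier L. f (heyting_imp L a b) \<sqsubseteq>\<^bsub>M\<^esub> heyting_imp M (f a) (f b)) \<and>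
     (\<forall>X \<subseteq> carrier L \<times> carrier L.
       (\<forall>p\<in>X. fst p \<sqsubseteq>\<^bsub>L\<^esub> snd p) \<longrightarrow> (\<forall>p\<in>X. f (fst p) \<sqsubseteq>\<^bsub>M\<^esub> f (snd p)))"
    (is "_ \<longleftrightarrow> ?simplified")
  proof (cases "f \<in> carrier L \<rightarrow>\<^sub>E carrier M")
    case True
    then have fc: "a \<in> carrier L \<Longrightarrow> f a \<in> carrier M" for a
      by auto
    have "realized (frame_arrow_algebra M) (carrier L \<times> carrier L) (\<lambda>p. heyting_imp M
        (f (heyting_imp L (fst p) (snd p))) (heyting_imp M (f (fst p)) (f (snd p)))) \<longleftrightarrow>
      (\<forall>p\<in>carrier L \<times> carrier L.
        f (heyting_imp L (fst p) (snd p)) \<sqsubseteq>\<^bsub>M\<^esub> heyting_imp M (f (fst p)) (f (snd p)))"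
      by (rule realized_heyting_imp_iff[OF M])
        (auto intro!: fc L.heyting_imp_closed M.heyting_imp_closed)
    moreover have "realized (frame_arrow_algebra L) X (\<lambda>p. heyting_imp L (fst p) (snd p)) \<longleftrightarrow>
        (\<forall>p\<in>X. fst p \<sqsubseteq>\<^bsub>L\<^esub> snd p)"
      and "realized (frame_arrow_algebra M) X (\<lambda>p. heyting_imp M (f (fst p)) (f (snd p))) \<longleftrightarrow>
        (\<forall>p\<in>X. f (fst p) \<sqsubseteq>\<^bsub>M\<^esub> f (snd p))" if "X \<subseteq> carrier L \<times> carrier L" for X
      using that by (intro realized_heyting_imp_iff L M; force intro: fc)+
    ultimately show ?thesis
      using True
      by (simp add: implicative_morphism_iff_realized[OF arrow_algebra_frame[OF L] arrow_algebra_frame[OF M]])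
  qed (simp add: implicative_morphism_def)
  also have "\<dots> \<longleftrightarrow> ?meet"
  proof
    assume impl: ?simplified
    then have fc: "a \<in> carrier L \<Longrightarrow> f a \<in> carrier M" for a
      by auto
    have imp: "f (heyting_imp L a b) \<sqsubseteq>\<^bsub>M\<^esub> heyting_imp M (f a) (f b)"
      if "a \<in> carrier L" "b \<in> carrier L" for a b
      using impl that by blast
    have mono: "f a \<sqsubseteq>\<^bsub>M\<^esub> f b" if "a \<in> carrier L" "b \<in> carrier L" "a \<sqsubseteq>\<^bsub>L\<^esub> b" for a b
      using impl[THEN conjunct2, THEN conjunct2, THEN conjunct2, rule_format, of "{(a, b)}" "(a, b)"]
        that by simp
    have "f (a \<sqinter>\<^bsub>L\<^esub> b) = f a \<sqinter>\<^bsub>M\<^esub> f b" if ab: "a \<in> carrier L" "b \<in> carrier L" for a b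
    proof (rule M.le_antisym)
      let ?m = "a \<sqinter>\<^bsub>L\<^esub> b"
      have m: "?m \<in> carrier L"
        using ab by simp
      show "f ?m \<sqsubseteq>\<^bsub>M\<^esub> f a \<sqinter>\<^bsub>M\<^esub> f b"
        using ab m by (intro M.meet_le mono fc L.meet_left L.meet_right)
      have "f a \<sqsubseteq>\<^bsub>M\<^esub> f (heyting_imp L b ?m)"
        using ab m by (intro mono L.le_heyting_impI) auto
      also have "\<dots> \<sqsubseteq>\<^bsub>M\<^esub> heyting_imp M (f b) (f ?m)"
        using ab m by (intro imp)
      finally show "f a \<sqinter>\<^bsub>M\<^esub> f b \<sqsubseteq>\<^bsub>M\<^esub> f ?m"
        using ab m fc L.heyting_imp_closed M.heyting_imp_closed M.heyting_imp_adjoint by simp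
    qed (use ab fc in auto)
    then show ?meet
      using impl by blast
  next
    assume meet: ?meet
    then have fc: "a \<in> carrier L \<Longrightarrow> f a \<in> carrier M" for a
      by auto
    have mono: "f a \<sqsubseteq>\<^bsub>M\<^esub> f b" if "a \<in> carrier L" "b \<in> carrier L" "a \<sqsubseteq>\<^bsub>L\<^esub> b" for a b
      using L.meet_preserving_mono[OF _ M _ that] meet by blast
    have "f (heyting_imp L a b) \<sqsubseteq>\<^bsub>M\<^esub> heyting_imp M (f a) (f b)"
      if ab: "a \<in> carrier L" "b \<in> carrier L" for a b
    proof (rule M.le_heyting_impI)
      have h: "heyting_imp L a b \<in> carrier L"
        by (rule L.heyting_imp_closed)
      have "f (heyting_imp L a b) \<sqinter>\<^bsub>M\<^esub> f a = f (heyting_imp L a b \<sqinter>\<^bsub>L\<^esub> a)"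
        using meet ab h by simp
      also have "\<dots> \<sqsubseteq>\<^bsub>M\<^esub> f b"
        using ab h L.heyting_imp_adjoint[of a b "heyting_imp L a b"] by (intro mono) auto
      finally show "f (heyting_imp L a b) \<sqinter>\<^bsub>M\<^esub> f a \<sqsubseteq>\<^bsub>M\<^esub> f b" .
    qed (use ab fc L.heyting_imp_closed in auto)
    then show ?simplified
      using meet mono by (auto simp: subset_iff)
  qed
  finally show ?thesis .
qed

text \<open>Finite meets reduce to the top element and binary meets.\<close>

lemma frame_homs_iff:
  assumes L: "frame L" and M: "frame M"
  shows "f \<in> frame_homs L M \<longleftrightarrow> f \<in> carrier L \<rightarrow>\<^sub>E carrier M \<and> f \<top>\<^bsub>L\<^esub> = \<top>\<^bsub>M\<^esub> \<and>
     (\<forall>a\<in>carrier L. \<forall>b\<in>carrier L. f (a \<sqinter>\<^bsub>L\<^esub> b) = f a \<sqinter>\<^bsub>M\<^esub> f b) \<and>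
     (\<forall>X \<subseteq> carrier L. f (\<Squnion>\<^bsub>L\<^esub> X) = \<Squnion>\<^bsub>M\<^esub> (f ` X))" (is "_ \<longleftrightarrow> ?rhs")
proof
  interpret L: frame L by fact
  interpret M: frame M by fact
  show ?rhs if f: "f \<in> frame_homs L M"
  proof -
    have fin: "X \<subseteq> carrier L \<Longrightarrow> finite X \<Longrightarrow> f (\<Sqinter>\<^bsub>L\<^esub> X) = \<Sqinter>\<^bsub>M\<^esub> (f ` X)" for X
      using f unfolding frame_homs_def by blast
    have "f (a \<sqinter>\<^bsub>L\<^esub> b) = f a \<sqinter>\<^bsub>M\<^esub> f b" if "a \<in> carrier L" "b \<in> carrier L" for a b
      using fin[of "{a, b}"] that by (simp add: meet_def)
    moreover have "f \<top>\<^bsub>L\<^esub> = \<top>\<^bsub>M\<^esub>"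
      using fin[of "{}"] L.inf_eq_topI[of "{}"] M.inf_eq_topI[of "{}"] by simp
    ultimately show ?thesis
      using f unfolding frame_homs_def by simp
  qed
  show "f \<in> frame_homs L M" if f: ?rhs
  proof -
    have "f (\<Sqinter>\<^bsub>L\<^esub> X) = \<Sqinter>\<^bsub>M\<^esub> (f ` X)" if "finite X" "X \<subseteq> carrier L" for X
      using that
    proof (induction X)
      case empty then show ?case
        using f L.inf_eq_topI[of "{}"] M.inf_eq_topI[of "{}"] by simp
    next
      case (insert x X)
      have "f ` X \<subseteq> carrier M" "f x \<in> carrier M"
        using insert.prems f by auto
      then show ?case
        using insert f by (simp add: L.inf_insert_meet M.inf_insert_meet)
    qed
    then show ?thesis
      using f unfolding frame_homs_def by blast
  qed
qed

lemma computationally_dense_frame_iff: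
  assumes L: "frame L" and M: "frame M" and f: "f \<in> carrier L \<rightarrow> carrier M"
  shows "computationally_dense (frame_arrow_algebra L) (frame_arrow_algebra M) f \<longleftrightarrow>
     (\<exists>h. implicative_morphism (frame_arrow_algebra M) (frame_arrow_algebra L) h \<and>
        (\<forall>b\<in>carrier M. f (h b) \<sqsubseteq>\<^bsub>M\<^esub> b) \<and> (\<forall>a\<in>carrier L. a \<sqsubseteq>\<^bsub>L\<^esub> h (f a)))"
proof -
  have "realized (frame_arrow_algebra M) (carrier M) (\<lambda>b. heyting_imp M (f (h b)) b) \<longleftrightarrow>
      (\<forall>b\<in>carrier M. f (h b) \<sqsubseteq>\<^bsub>M\<^esub> b)"
    and "realized (frame_arrow_algebra L) (carrier L) (\<lambda>a. heyting_imp L a (h (f a))) \<longleftrightarrow>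
      (\<forall>a\<in>carrier L. a \<sqsubseteq>\<^bsub>L\<^esub> h (f a))"
    if h: "implicative_morphism (frame_arrow_algebra M) (frame_arrow_algebra L) h" for h
  proof -
    have h': "h \<in> carrier M \<rightarrow> carrier L"
      using implicative_morphism_funcset[OF h] by simp
    note carr = funcset_mem[OF f] funcset_mem[OF h']
    show "realized (frame_arrow_algebra M) (carrier M) (\<lambda>b. heyting_imp M (f (h b)) b) \<longleftrightarrow>
        (\<forall>b\<in>carrier M. f (h b) \<sqsubseteq>\<^bsub>M\<^esub> b)"
      by (rule realized_heyting_imp_iff[OF M]) (simp_all add: carr)
    show "realized (frame_arrow_algebra L) (carrier L) (\<lambda>a. heyting_imp L a (h (f a))) \<longleftrightarrow>
        (\<forall>a\<in>carrier L. a \<sqsubseteq>\<^bsub>L\<^esub> h (f a))"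
      by (rule realized_heyting_imp_iff[OF L]) (simp_all add: carr)
  qed
  then show ?thesis
    using computationally_dense_iff_realized[OF arrow_algebra_frame[OF L] arrow_algebra_frame[OF M], of f] f
    by (simp cong: conj_cong)
qed

text \<open>A join-preserving \<open>f\<close> has the right adjoint \<open>h b = \<Squnion> {a. f a \<le> b}\<close>: preservation of this very
  join is what yields \<open>f (h b) \<le> b\<close>. As a right adjoint, \<open>h\<close> preserves meets and is therefore
  implicative.\<close>

lemma frame_homs_subset_cd_morphisms:
  assumes L: "frame L" and M: "frame M" and f: "f \<in> frame_homs L M"
  shows "f \<in> cd_morphisms (frame_arrow_algebra L) (frame_arrow_algebra M)"
proof -
  interpret L: frame L by fact
  interpret M: frame M by fact
  have fE: "f \<in> carrier L \<rightarrow>\<^sub>E carrier M" and ftop: "f \<top>\<^bsub>L\<^esub> = \<top>\<^bsub>M\<^esub>"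
    and fmeet: "\<forall>a\<in>carrier L. \<forall>b\<in>carrier L. f (a \<sqinter>\<^bsub>L\<^esub> b) = f a \<sqinter>\<^bsub>M\<^esub> f b"
    and fsup: "\<And>X. X \<subseteq> carrier L \<Longrightarrow> f (\<Squnion>\<^bsub>L\<^esub> X) = \<Squnion>\<^bsub>M\<^esub> (f ` X)"
    using f unfolding frame_homs_iff[OF L M] by auto
  have fc: "a \<in> carrier L \<Longrightarrow> f a \<in> carrier M" for a
    using fE by auto
  have mono: "f a \<sqsubseteq>\<^bsub>M\<^esub> f b" if "a \<in> carrier L" "b \<in> carrier L" "a \<sqsubseteq>\<^bsub>L\<^esub> b" for a b
    using L.meet_preserving_mono[OF _ M fmeet that] fE by blast
  define h where "h = (\<lambda>b\<in>carrier M. \<Squnion>\<^bsub>L\<^esub> {a \<in> carrier L. f a \<sqsubseteq>\<^bsub>M\<^esub> b})"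
  have hE: "h \<in> carrier M \<rightarrow>\<^sub>E carrier L"
    unfolding h_def by (auto intro!: L.sup_closed)
  then have hc: "b \<in> carrier M \<Longrightarrow> h b \<in> carrier L" for b
    by auto
  have fh: "f (h b) \<sqsubseteq>\<^bsub>M\<^esub> b" if b: "b \<in> carrier M" for b
  proof -
    have "f (h b) = \<Squnion>\<^bsub>M\<^esub> (f ` {a \<in> carrier L. f a \<sqsubseteq>\<^bsub>M\<^esub> b})"
      unfolding h_def using b by (simp add: fsup)
    also have "\<dots> \<sqsubseteq>\<^bsub>M\<^esub> b"
      using b by (intro M.sup_least) (auto simp: fc)
    finally show ?thesis .
  qed
  have adj: "f a \<sqsubseteq>\<^bsub>M\<^esub> b \<longleftrightarrow> a \<sqsubseteq>\<^bsub>L\<^esub> h b" if ab: "a \<in> carrier L" "b \<in> carrier M" for a b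
  proof
    show "a \<sqsubseteq>\<^bsub>L\<^esub> h b" if "f a \<sqsubseteq>\<^bsub>M\<^esub> b"
      unfolding h_def using that ab by (auto intro: L.sup_upper)
    show "f a \<sqsubseteq>\<^bsub>M\<^esub> b" if "a \<sqsubseteq>\<^bsub>L\<^esub> h b"
      using mono[OF _ _ that] fh[of b] ab fc hc by (meson M.le_trans)
  qed
  have "h \<top>\<^bsub>M\<^esub> = \<top>\<^bsub>L\<^esub>"
    using hc adj[of "\<top>\<^bsub>L\<^esub>" "\<top>\<^bsub>M\<^esub>"] by (simp add: L.eq_top_iff fc)
  moreover have "h (b \<sqinter>\<^bsub>M\<^esub> b') = h b \<sqinter>\<^bsub>L\<^esub> h b'" if b: "b \<in> carrier M" "b' \<in> carrier M" for b b'
  proof (rule L.le_antisym)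
    let ?m = "b \<sqinter>\<^bsub>M\<^esub> b'" and ?n = "h b \<sqinter>\<^bsub>L\<^esub> h b'"
    have carr: "?m \<in> carrier M" "?n \<in> carrier L"
      using b hc by auto
    have "f (h ?m) \<sqsubseteq>\<^bsub>M\<^esub> b" "f (h ?m) \<sqsubseteq>\<^bsub>M\<^esub> b'"
      using fh[OF carr(1)] M.meet_left[OF b] M.meet_right[OF b] b carr fc hc
      by (meson M.le_trans)+
    then show "h ?m \<sqsubseteq>\<^bsub>L\<^esub> ?n"
      using b carr hc by (intro L.meet_le) (simp_all add: adj[symmetric])
    have "f ?n \<sqsubseteq>\<^bsub>M\<^esub> ?m"
      using b carr hc fc by (intro M.meet_le) (simp_all add: adj L.meet_left L.meet_right)
    then show "?n \<sqsubseteq>\<^bsub>L\<^esub> h ?m"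
      using carr by (simp add: adj)
  qed (use b hc in auto)
  ultimately have "implicative_morphism (frame_arrow_algebra M) (frame_arrow_algebra L) h"
    using hE by (simp add: implicative_morphism_frame_iff[OF M L])
  moreover have "\<forall>a\<in>carrier L. a \<sqsubseteq>\<^bsub>L\<^esub> h (f a)"
    using fc by (simp add: adj[symmetric])
  ultimately have "computationally_dense (frame_arrow_algebra L) (frame_arrow_algebra M) f"
    using fE fh by (subst computationally_dense_frame_iff[OF L M]) (auto simp: PiE_def)
  then show ?thesis
    unfolding cd_morphisms_def
    using fE ftop fmeet by (simp add: implicative_morphism_frame_iff[OF L M])
qed

text \<open>The density witness \<open>h\<close> is a right adjoint of \<open>f\<close>, and left adjoints preserve joins.\<close>

lemma cd_morphisms_subset_frame_homs:
  assumes L: "frame L" and M: "frame M"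
    and f: "f \<in> cd_morphisms (frame_arrow_algebra L) (frame_arrow_algebra M)"
  shows "f \<in> frame_homs L M"
proof -
  interpret L: frame L by fact
  interpret M: frame M by fact
  have fE: "f \<in> carrier L \<rightarrow>\<^sub>E carrier M" and ftop: "f \<top>\<^bsub>L\<^esub> = \<top>\<^bsub>M\<^esub>"
    and fmeet: "\<forall>a\<in>carrier L. \<forall>b\<in>carrier L. f (a \<sqinter>\<^bsub>L\<^esub> b) = f a \<sqinter>\<^bsub>M\<^esub> f b"
    using f unfolding cd_morphisms_def by (auto simp: implicative_morphism_frame_iff[OF L M])
  then have f': "f \<in> carrier L \<rightarrow> carrier M" and fc: "\<And>a. a \<in> carrier L \<Longrightarrow> f a \<in> carrier M"
    by auto
  obtain h where h: "implicative_morphism (frame_arrow_algebra M) (frame_arrow_algebra L) h"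
    and fh: "\<And>b. b \<in> carrier M \<Longrightarrow> f (h b) \<sqsubseteq>\<^bsub>M\<^esub> b"
    and hf: "\<And>a. a \<in> carrier L \<Longrightarrow> a \<sqsubseteq>\<^bsub>L\<^esub> h (f a)"
    using f unfolding cd_morphisms_def computationally_dense_frame_iff[OF L M f'] mem_Collect_eq
    by (elim conjE exE) blast
  have h': "h \<in> carrier M \<rightarrow> carrier L"
    and hmeet: "\<forall>a\<in>carrier M. \<forall>b\<in>carrier M. h (a \<sqinter>\<^bsub>M\<^esub> b) = h a \<sqinter>\<^bsub>L\<^esub> h b"
    using h by (auto simp: implicative_morphism_frame_iff[OF M L])
  have "f (\<Squnion>\<^bsub>L\<^esub> X) = \<Squnion>\<^bsub>M\<^esub> (f ` X)" if X: "X \<subseteq> carrier L" for X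
  proof (rule M.le_antisym)
    let ?s = "\<Squnion>\<^bsub>M\<^esub> (f ` X)"
    have fX: "f ` X \<subseteq> carrier M"
      using X fc by auto
    then have s: "?s \<in> carrier M" "h ?s \<in> carrier L" "\<Squnion>\<^bsub>L\<^esub> X \<in> carrier L"
      using X h' by auto
    have "x \<sqsubseteq>\<^bsub>L\<^esub> h ?s" if "x \<in> X" for x
    proof -
      have x: "x \<in> carrier L" "f x \<in> carrier M"
        using that X fc by auto
      then have "h (f x) \<in> carrier L"
        using h' by auto
      have "h (f x) \<sqsubseteq>\<^bsub>L\<^esub> h ?s"
        using that s x by (intro M.meet_preserving_mono[OF h' L hmeet] M.sup_upper[OF fX]) auto
      then show ?thesis
        using hf[OF x(1)] x \<open>h (f x) \<in> carrier L\<close> s by (meson L.le_trans)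
    qed
    then have "\<Squnion>\<^bsub>L\<^esub> X \<sqsubseteq>\<^bsub>L\<^esub> h ?s"
      using s X by (intro L.sup_least)
    then have "f (\<Squnion>\<^bsub>L\<^esub> X) \<sqsubseteq>\<^bsub>M\<^esub> f (h ?s)"
      using s by (intro L.meet_preserving_mono[OF f' M fmeet])
    then show "f (\<Squnion>\<^bsub>L\<^esub> X) \<sqsubseteq>\<^bsub>M\<^esub> ?s"
      using fh s fc by (meson M.le_trans)
    show "?s \<sqsubseteq>\<^bsub>M\<^esub> f (\<Squnion>\<^bsub>L\<^esub> X)"
    proof (rule M.sup_least[OF fX])
      fix y assume "y \<in> f ` X"
      then show "y \<sqsubseteq>\<^bsub>M\<^esub> f (\<Squnion>\<^bsub>L\<^esub> X)"
        using s X by (auto intro!: L.meet_preserving_mono[OF f' M fmeet] L.sup_upper)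
    qed (use s fc in auto)
  qed (use X fc in \<open>auto intro!: M.sup_closed L.sup_closed\<close>)
  then show ?thesis
    using fE ftop fmeet by (simp add: frame_homs_iff[OF L M])
qed

text \<open>The two categories have the same hom-sets between frames, as an equality of sets of functions, so
  that the equivalence of hom-preorders is the identity.\<close>

lemma cd_morphisms_frame:
  assumes "frame L" "frame M"
  shows "cd_morphisms (frame_arrow_algebra L) (frame_arrow_algebra M) = frame_homs L M"
  using frame_homs_subset_cd_morphisms[OF assms] cd_morphisms_subset_frame_homs[OF assms] by blast

lemma entails_frame_homs_iff:
  assumes L: "frame L" and M: "frame M" and "f \<in> frame_homs L M" "g \<in> frame_homs L M"
  shows "entails (frame_arrow_algebra L) (frame_arrow_algebra M) f g \<longleftrightarrow> pointwise_le L M f g"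
  by (rule entails_frame_iff[OF L M]) (use assms in \<open>auto simp: frame_homs_def\<close>)


section \<open>The inclusion of frames\<close>

lemma preorder_equivalence_id:
  assumes P: "preorder_on_set P leP" and eq: "Q = P"
    and le: "\<And>x y. x \<in> P \<Longrightarrow> y \<in> P \<Longrightarrow> leQ x y \<longleftrightarrow> leP x y"
  shows "preorder_equivalence P leP Q leQ (\<lambda>x. x)"
proof -
  have "preorder_on_set Q leQ \<longleftrightarrow> preorder_on_set P leP"
    unfolding preorder_on_set_def eq by (simp add: le)
  then have "preorder_on_set Q leQ"
    using P by simp
  moreover have "monotone_map P leP Q leQ (\<lambda>x. x)" "monotone_map Q leQ P leP (\<lambda>x. x)"
    unfolding monotone_map_def eq by (auto simp: le)
  moreover have "leP x x" "leQ x x" if "x \<in> P" for x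
    using P[unfolded preorder_on_set_def, THEN conjunct1] that by (simp_all add: le)
  ultimately show ?thesis
    using P unfolding preorder_equivalence_def eq by (intro conjI exI[of _ "\<lambda>x. x"]) simp_all
qed

lemma preorder_on_set_frame_homs:
  assumes M: "frame M"
  shows "preorder_on_set (frame_homs L M) (pointwise_le L M)"
proof -
  interpret M: frame M by fact
  have carr: "f x \<in> carrier M" if "f \<in> frame_homs L M" "x \<in> carrier L" for f x
    using that unfolding frame_homs_def by auto
  show ?thesis
    unfolding preorder_on_set_def pointwise_le_def
  proof (intro conjI ballI impI)
    show "f x \<sqsubseteq>\<^bsub>M\<^esub> f x" if "f \<in> frame_homs L M" "x \<in> carrier L" for f x
      using that by (intro M.le_refl carr)
    show "f x \<sqsubseteq>\<^bsub>M\<^esub> h x"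
      if "f \<in> frame_homs L M" "g \<in> frame_homs L M" "h \<in> frame_homs L M"
        "\<forall>x\<in>carrier L. f x \<sqsubseteq>\<^bsub>M\<^esub> g x" "\<forall>x\<in>carrier L. g x \<sqsubseteq>\<^bsub>M\<^esub> h x"
        "x \<in> carrier L" for f g h x
      using that by (intro M.le_trans[of "f x" "g x" "h x"]) (auto simp: carr)
  qed
qed

lemma preorder_equivalence_frame_homs:
  assumes L: "frame L" and M: "frame M"
  shows "preorder_equivalence (frame_homs L M) (pointwise_le L M)
     (cd_morphisms (frame_arrow_algebra L) (frame_arrow_algebra M))
     (entails (frame_arrow_algebra L) (frame_arrow_algebra M)) (\<lambda>f. f)"
proof (rule preorder_equivalence_id)
  show "preorder_on_set (frame_homs L M) (pointwise_le L M)"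
    by (rule preorder_on_set_frame_homs[OF M])
  show "cd_morphisms (frame_arrow_algebra L) (frame_arrow_algebra M) = frame_homs L M"
    by (rule cd_morphisms_frame[OF L M])
qed (rule entails_frame_homs_iff[OF L M])

text \<open>A functor that is the identity on hom-preorders transports the laws of its codomain back to its
  domain, so those of the domain need no separate proof.\<close>

lemma two_fully_faithful_full_subcategory:
  assumes D: "preorder_enriched_category D"
    and obj: "\<And>X. X \<in> Obj C \<Longrightarrow> F0 X \<in> Obj D"
    and hom: "\<And>X Y. X \<in> Obj C \<Longrightarrow> Y \<in> Obj C \<Longrightarrow> Hom C X Y = Hom D (F0 X) (F0 Y)"
    and le: "\<And>X Y f g. X \<in> Obj C \<Longrightarrow> Y \<in> Obj C \<Longrightarrow> f \<in> Hom C X Y \<Longrightarrow> g \<in> Hom C X Y \<Longrightarrow>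
      Hle C X Y f g \<longleftrightarrow> Hle D (F0 X) (F0 Y) f g"
    and idn: "\<And>X. X \<in> Obj C \<Longrightarrow> Idn C X = Idn D (F0 X)"
    and cmp: "\<And>X Y Z f g. X \<in> Obj C \<Longrightarrow> Y \<in> Obj C \<Longrightarrow> Z \<in> Obj C \<Longrightarrow>
      Cmp C X Y Z g f = Cmp D (F0 X) (F0 Y) (F0 Z) g f"
  shows "two_fully_faithful_two_functor C D F0 (\<lambda>X Y f. f)"
proof -
  interpret D: preorder_enriched_category D by fact
  interpret C: preorder_enriched_category C
  proof (unfold_locales, goal_cases)
    case 1 then show ?case by (simp add: obj hom idn D.Idn_in_Hom)
  next
    case (2 X Y Z f g) then show ?case
      using D.Cmp_in_Hom[of "F0 X" "F0 Y" "F0 Z" f g] by (simp add: obj hom cmp)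
  next
    case 3 then show ?case by (simp add: obj hom idn cmp D.Idn_left)
  next
    case 4 then show ?case by (simp add: obj hom idn cmp D.Idn_right)
  next
    case 5 then show ?case by (simp add: obj hom cmp D.Cmp_assoc)
  next
    case 6 then show ?case by (simp add: obj hom le D.Hle_refl)
  next
    case (7 X Y f g h) then show ?case
      using D.Hle_trans[of "F0 X" "F0 Y" f g h] by (simp add: obj hom le)
  next
    case (8 X Y Z f f' g g') then show ?case
      using D.Cmp_mono[of "F0 X" "F0 Y" "F0 Z" f f' g g']
        D.Cmp_in_Hom[of "F0 X" "F0 Y" "F0 Z" f g] D.Cmp_in_Hom[of "F0 X" "F0 Y" "F0 Z" f' g']
      by (simp add: obj hom cmp le)
  qed
  show ?thesis
  proof (unfold_locales, goal_cases)
    case (6 X Y)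
    have "preorder_on_set (Hom C X Y) (Hle C X Y)"
      using 6 C.Hle_refl C.Hle_trans unfolding preorder_on_set_def by blast
    then show ?case
      using 6 by (intro preorder_equivalence_id) (simp_all add: hom le)
  qed (simp_all add: obj hom le idn cmp)
qed

lemma two_fully_faithful_frame_inclusion:
  "two_fully_faithful_two_functor Frm ArrAlg_cd frame_arrow_algebra (\<lambda>L M f. f)"
  by (rule two_fully_faithful_full_subcategory[OF preorder_enriched_category_ArrAlg_cd])
    (simp_all add: Frm_def ArrAlg_cd_def arrow_algebra_frame cd_morphisms_frame entails_frame_homs_iff)

theorem proposition6p2:
  fixes OY :: "'y gorder" and OX :: "'x gorder"
  shows "two_fully_faithful_two_functor
           (Frm :: ('u gorder, 'u \<Rightarrow> 'u) precat) ArrAlg_cd frame_arrow_algebra (\<lambda>L M f. f)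
       \<and> (frame OY \<and> frame OX \<longrightarrow>
           preorder_equivalence
             (frame_homs OY OX) (pointwise_le OY OX)
             (cd_morphisms (frame_arrow_algebra OY) (frame_arrow_algebra OX))
             (entails (frame_arrow_algebra OY) (frame_arrow_algebra OX))
             (\<lambda>f. f))"
  using two_fully_faithful_frame_inclusion preorder_equivalence_frame_homs by blast

end
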